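(* Let $\mathbb{K}$ be a field of characteristic $0$, $R=\mathbb{K}[x_1,\dots,x_n]$, $P\subseteq R$ a maximal ideal and $I\subseteq R$ a $P$-primary ideal. (1) If $\{D_i\}_i$ spans $D_P[I]$ as a $\kappa(P)$-vector space, then any choice of preimages $\{N_i\}_i\subseteq W_R$ of $\{D_i\}_i$ under the natural map $W_R\to W_{\kappa(P)}$ is a set of Noetherian operators for $I$. (2) Conversely, if $\{N_i\}_i\subseteq W_R$ is a set of Noetherian operators for $I$, then their images in $W_{\kappa(P)}$ span $D_P[I]$ over $\kappa(P)$.
   Context: $W_R=R\langle\partial_1,\dots,\partial_n\rangle$ is the Weyl algebra ($\partial_i=\partial/\partial x_i$) acting on $R$ by differentiation/multiplication, written $D\bullet f$. A set $N\subseteq W_R$ is a set of Noetherian operators for an ideal $I$ if for all $f\in R$: $f\in I\iff D\bullet f\in\sqrt I$ for all $D\in N$. $W_{\kappa(P)}:=\kappa(P)\otimes_R W_R$, whose elements are $\sum_\alpha c_\alpha\partial^\alpha$ with $c_\alpha\in\kappa(P)$; the map $W_R\to W_{\kappa(P)}$ reduces coefficients modulo $P$. Pairing: $\langle\sum_\alpha c_\alpha\partial^\alpha,f\rangle=\sum_\alpha c_\alpha\overline{\partial^\alpha f}\in\kappa(P)$ for $f\in R$. Local dual space: $D_P[I]=\{D\in W_{\kappa(P)}:\langle D,f\rangle=0\ \forall f\in I\}$. *)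

theory Defs
  imports "HOL-Library.Poly_Mapping"
begin

type_synonym ('n, 'k) mpoly = "('n \<Rightarrow>\<^sub>0 nat) \<Rightarrow>\<^sub>0 'k"

text \<open>Weyl algebra W_R: every element is uniquely sum_alpha c_alpha d^alpha with c_alpha in R;
  represented by the finitely supported coefficient map alpha |-> c_alpha.\<close>
type_synonym ('n, 'k) weyl = "('n \<Rightarrow>\<^sub>0 nat) \<Rightarrow>\<^sub>0 ('n, 'k) mpoly"

definition is_ideal :: "'a::comm_ring_1 set \<Rightarrow> bool" where
  "is_ideal I \<longleftrightarrow> 0 \<in> I \<and> (\<forall>a\<in>I. \<forall>b\<in>I. a + b \<in> I) \<and> (\<forall>r. \<forall>a\<in>I. r * a \<in> I)"

definition radical :: "'a::comm_ring_1 set \<Rightarrow> 'a set" where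
  "radical I = {f. \<exists>k::nat. f ^ k \<in> I}"

definition maximal_ideal :: "'a::comm_ring_1 set \<Rightarrow> bool" where
  "maximal_ideal P \<longleftrightarrow> is_ideal P \<and> P \<noteq> UNIV \<and>
     (\<forall>J. is_ideal J \<longrightarrow> P \<subseteq> J \<longrightarrow> J = P \<or> J = UNIV)"

definition primary_ideal :: "'a::comm_ring_1 set \<Rightarrow> bool" where
  "primary_ideal I \<longleftrightarrow> is_ideal I \<and> I \<noteq> UNIV \<and>
     (\<forall>a b. a * b \<in> I \<longrightarrow> a \<notin> I \<longrightarrow> b \<in> radical I)"

definition P_primary :: "'a::comm_ring_1 set \<Rightarrow> 'a set \<Rightarrow> bool" where
  "P_primary P I \<longleftrightarrow> primary_ideal I \<and> radical I = P"

text \<open>d^alpha x^beta = (prod_i beta_i!/(beta_i-alpha_i)!) x^(beta-alpha) if alpha <= beta, else 0.\<close>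
definition diff_coeff :: "('n::finite \<Rightarrow>\<^sub>0 nat) \<Rightarrow> ('n \<Rightarrow>\<^sub>0 nat) \<Rightarrow> nat" where
  "diff_coeff \<alpha> \<beta> = (if (\<forall>i. Poly_Mapping.lookup \<alpha> i \<le> Poly_Mapping.lookup \<beta> i)
     then (\<Prod>i\<in>UNIV. fact (Poly_Mapping.lookup \<beta> i) div fact (Poly_Mapping.lookup \<beta> i - Poly_Mapping.lookup \<alpha> i)) else 0)"

definition pdiff :: "('n::finite \<Rightarrow>\<^sub>0 nat) \<Rightarrow> ('n, 'k::comm_ring_1) mpoly \<Rightarrow> ('n, 'k) mpoly" where
  "pdiff \<alpha> p = (\<Sum>\<beta>\<in>Poly_Mapping.keys p. Poly_Mapping.single (\<beta> - \<alpha>) (of_nat (diff_coeff \<alpha> \<beta>) * Poly_Mapping.lookup p \<beta>))"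

definition wact :: "('n::finite, 'k::comm_ring_1) weyl \<Rightarrow> ('n, 'k) mpoly \<Rightarrow> ('n, 'k) mpoly" where
  "wact D f = (\<Sum>\<alpha>\<in>Poly_Mapping.keys D. Poly_Mapping.lookup D \<alpha> * pdiff \<alpha> f)"

definition noetherian_operators :: "('n::finite, 'k::comm_ring_1) weyl set \<Rightarrow> ('n, 'k) mpoly set \<Rightarrow> bool" where
  "noetherian_operators N I \<longleftrightarrow> (\<forall>f. f \<in> I \<longleftrightarrow> (\<forall>D\<in>N. wact D f \<in> radical I))"

text \<open>kappa(P) = R/P. An element of W_kappa(P) is represented by an element of W_R
  (a preimage under the reduction map W_R -> W_kappa(P)); two elements of W_R have the
  same image iff all coefficients agree modulo P.\<close>
definition same_image :: "('n, 'k::comm_ring_1) mpoly set \<Rightarrow> ('n, 'k) weyl \<Rightarrow> ('n, 'k) weyl \<Rightarrow> bool" where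
  "same_image P D E \<longleftrightarrow> (\<forall>\<alpha>. Poly_Mapping.lookup D \<alpha> - Poly_Mapping.lookup E \<alpha> \<in> P)"

text \<open>The pairing <D, f> = sum_alpha c_alpha (d^alpha f mod P) equals the residue of D \<bullet> f
  modulo P, hence vanishes iff D \<bullet> f is in P. local_dual P I is the set of all preimages in
  W_R of elements of D_P[I].\<close>
definition local_dual :: "('n::finite, 'k::comm_ring_1) mpoly set \<Rightarrow> ('n, 'k) mpoly set \<Rightarrow> ('n, 'k) weyl set" where
  "local_dual P I = {D. \<forall>f\<in>I. wact D f \<in> P}"

definition wscale :: "('n, 'k::comm_ring_1) mpoly \<Rightarrow> ('n, 'k) weyl \<Rightarrow> ('n, 'k) weyl" where
  "wscale r D = Poly_Mapping.map (\<lambda>c. r * c) D"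

text \<open>The kappa(P)-span of the images of a set S of Weyl elements, as a set of preimages:
  D lies in it iff image(D) = sum_j c_j image(E_j) with c_j in kappa(P) (represented by r_j in R).\<close>
definition kspan :: "('n, 'k::comm_ring_1) mpoly set \<Rightarrow> ('n, 'k) weyl set \<Rightarrow> ('n, 'k) weyl set" where
  "kspan P S = {D. \<exists>F c. finite F \<and> F \<subseteq> S \<and> same_image P D (\<Sum>E\<in>F. wscale (c E) E)}"

definition spans_local_dual :: "('n::finite, 'k::comm_ring_1) mpoly set \<Rightarrow> ('n, 'k) mpoly set \<Rightarrow> ('n, 'k) weyl set \<Rightarrow> bool" where
  "spans_local_dual P I S \<longleftrightarrow> S \<subseteq> local_dual P I \<and> local_dual P I \<subseteq> kspan P S"

end

theory Submission
  imports Defs "HOL-Computational_Algebra.Polynomial"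
begin

text \<open>
  Write \<open>J\<^sub>m\<close> for the ideal of all \<open>f\<close> whose derivatives of order less than \<open>m\<close> lie in \<open>P\<close>.
  Zariski's lemma and characteristic \<open>0\<close> yield local parameters \<open>t\<^sub>1, \<dots>, t\<^sub>n \<in> P\<close> that generate \<open>P\<close>
  locally and satisfy \<open>\<partial>\<^sub>i t\<^sub>j \<equiv> \<delta>\<^sub>i\<^sub>j\<close> modulo \<open>P\<close>. Consequently the truncated Taylor map
  \<open>f \<mapsto> (\<partial>\<^sup>\<beta> f mod P)\<close>, \<open>|\<beta>| < m\<close>, is onto, and its kernel \<open>J\<^sub>m\<close> is contained in \<open>I\<close> for large \<open>m\<close>,
  because locally \<open>J\<^sub>m\<close> is generated by the monomials of degree \<open>m\<close> in \<open>t\<close>.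
  The image of \<open>I\<close> is a \<open>\<kappa>(P)\<close>-subspace (multiply by a lift of \<open>c \<in> \<kappa>(P)\<close> with vanishing higher
  derivatives), and \<open>D\<^sub>P[I]\<close> is its annihilator. Both claims are then the double annihilator theorem for
  finite-dimensional vector spaces. All linear algebra over \<open>\<kappa>(P)\<close> is carried out in \<open>R\<close> modulo \<open>P\<close>.
\<close>

section \<open>Polynomials over a subring modulo a maximal ideal\<close>

text \<open>For the ideal of a rational point \<open>a\<close> the parameters would be
  \<open>x_i - a_i\<close>. In general \<kappa>(P) is a proper extension of the base field that does
  not sit inside \<open>R\<close> as a ring of constants, so parameters and substitutes for
  constants have to be built. The parameters come from minimal polynomials of one variable over some
  of the others, which presupposes algebraicity. Hence the form of Zariski's lemma: the subring
  generated by any set of variables is, modulo \<open>P\<close>, a field after inverting one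
  element. Unlike being a field, this property passes from \<open>A[x]\<close> down to
  \<open>A\<close>. Characteristic 0 enters twice: it makes minimal polynomials separable, and it
  keeps the integer factors in derivatives of monomials in \<open>t\<close> outside
  \<open>P\<close>. Leading coefficients cannot be divided by. They are carried along as factors
  outside \<open>P\<close>, which is why localized ideals appear, and the primary hypothesis on
  \<open>I\<close> removes them at the end. The space \<open>D_P[I]\<close> is finite-dimensional
  because the inclusion of some \<open>J_m\<close> in \<open>I\<close> also bounds the order of its
  elements.\<close>

definition subring :: "'a::comm_ring_1 set \<Rightarrow> bool" where
  "subring A \<longleftrightarrow> 1 \<in> A \<and> (\<forall>a\<in>A. \<forall>b\<in>A. a - b \<in> A) \<and> (\<forall>a\<in>A. \<forall>b\<in>A. a * b \<in> A)"

lemma subringD: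
  assumes "subring A"
  shows subring_0: "0 \<in> A" and subring_1: "1 \<in> A"
    and subring_diff: "\<And>a b. a \<in> A \<Longrightarrow> b \<in> A \<Longrightarrow> a - b \<in> A"
    and subring_add: "\<And>a b. a \<in> A \<Longrightarrow> b \<in> A \<Longrightarrow> a + b \<in> A"
    and subring_mult: "\<And>a b. a \<in> A \<Longrightarrow> b \<in> A \<Longrightarrow> a * b \<in> A"
proof -
  show 1: "1 \<in> A" and d: "\<And>a b. a \<in> A \<Longrightarrow> b \<in> A \<Longrightarrow> a - b \<in> A"
    and "\<And>a b. a \<in> A \<Longrightarrow> b \<in> A \<Longrightarrow> a * b \<in> A"
    using assms by (auto simp: subring_def)
  show 0: "0 \<in> A" using d[OF 1 1] by simp
  show "a + b \<in> A" if "a \<in> A" "b \<in> A" for a b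
    using d[OF that(1) d[OF 0 that(2)]] by simp
qed

lemma subring_sum: "subring A \<Longrightarrow> (\<And>i. i \<in> F \<Longrightarrow> f i \<in> A) \<Longrightarrow> sum f F \<in> A"
  by (induction F rule: infinite_finite_induct) (auto simp: subringD)

lemma subring_power: "subring A \<Longrightarrow> a \<in> A \<Longrightarrow> a ^ k \<in> A"
  by (induction k) (auto simp: subringD)

definition polys_over :: "'a::comm_ring_1 set \<Rightarrow> 'a poly set" where
  "polys_over A = {p. \<forall>i. coeff p i \<in> A}"

lemma subring_polys_over: assumes "subring A" shows "subring (polys_over A)"
  unfolding subring_def
proof (intro conjI ballI)
  show "1 \<in> polys_over A"
    using subringD[OF assms] by (auto simp: polys_over_def coeff_1)
  show "p - q \<in> polys_over A" if "p \<in> polys_over A" "q \<in> polys_over A" for p q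
    using that subringD[OF assms] by (auto simp: polys_over_def)
  show "p * q \<in> polys_over A" if "p \<in> polys_over A" "q \<in> polys_over A" for p q
    using that subringD[OF assms]
    by (auto simp: polys_over_def coeff_mult intro!: subring_sum[OF assms])
qed

lemma monom_polys_over: "subring A \<Longrightarrow> c \<in> A \<Longrightarrow> monom c n \<in> polys_over A"
  by (auto simp: polys_over_def coeff_monom subringD)

lemma smult_polys_over: "subring A \<Longrightarrow> c \<in> A \<Longrightarrow> p \<in> polys_over A \<Longrightarrow> smult c p \<in> polys_over A"
  by (auto simp: polys_over_def subringD)

lemma pCons_polys_over: "subring A \<Longrightarrow> c \<in> A \<Longrightarrow> p \<in> polys_over A \<Longrightarrow> pCons c p \<in> polys_over A"
  by (auto simp: polys_over_def coeff_pCons subringD split: nat.splits)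

definition adjoin :: "'a::comm_ring_1 set \<Rightarrow> 'a \<Rightarrow> 'a set" where
  "adjoin A x = (\<lambda>p. poly p x) ` polys_over A"

lemma subring_adjoin: assumes "subring A" shows "subring (adjoin A x)"
proof -
  note s = subringD[OF subring_polys_over[OF assms]]
  show ?thesis
    unfolding subring_def adjoin_def
  proof (intro conjI ballI)
    show "1 \<in> (\<lambda>p. poly p x) ` polys_over A"
      by (rule image_eqI[of _ _ 1]) (simp_all add: s)
  next
    fix a b assume "a \<in> (\<lambda>p. poly p x) ` polys_over A" "b \<in> (\<lambda>p. poly p x) ` polys_over A"
    then obtain p q where "p \<in> polys_over A" "q \<in> polys_over A" "a = poly p x" "b = poly q x"
      by blast
    then show "a - b \<in> (\<lambda>p. poly p x) ` polys_over A" "a * b \<in> (\<lambda>p. poly p x) ` polys_over A"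
      using image_eqI[of "a - b" "\<lambda>p. poly p x" "p - q" "polys_over A"]
        image_eqI[of "a * b" "\<lambda>p. poly p x" "p * q" "polys_over A"]
      by (simp_all add: s)
  qed
qed

lemma adjoin_base: "subring A \<Longrightarrow> a \<in> A \<Longrightarrow> a \<in> adjoin A x"
  unfolding adjoin_def
  by (rule image_eqI[of _ _ "monom a 0"]) (auto simp: monom_polys_over poly_monom)

lemma adjoin_self: "subring A \<Longrightarrow> x \<in> adjoin A x"
  unfolding adjoin_def
  by (rule image_eqI[of _ _ "monom 1 1"]) (auto simp: monom_polys_over poly_monom subringD)

text \<open>The leading coefficient of \<open>g\<close> need not be invertible in \<open>A\<close>,
  so each step of the long division multiplies \<open>f\<close> by it. Phrasing the bound on the
  remainder by vanishing coefficients covers constant \<open>g\<close> as well, where the remainder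
  must be 0.\<close>

lemma pseudo_division:
  assumes A: "subring A" and g: "g \<in> polys_over A" and f: "f \<in> polys_over A"
  shows "\<exists>e. \<exists>h\<in>polys_over A. \<forall>i\<ge>degree g. coeff (smult (lead_coeff g ^ e) f - g * h) i = 0"
proof -
  note sA = subringD[OF A] and sp = subringD[OF subring_polys_over[OF A]]
  let ?l = "lead_coeff g"
  have l: "?l \<in> A" using g by (auto simp: polys_over_def)
  have "\<exists>e. \<exists>h\<in>polys_over A. \<forall>i\<ge>degree g. coeff (smult (?l ^ e) f - g * h) i = 0"
    if "f \<in> polys_over A" "\<forall>i\<ge>n. coeff f i = 0" for n
    using that
  proof (induction n arbitrary: f)
    case 0
    then show ?case by (intro exI[of _ 0] bexI[of _ 0]) (auto simp: sp)
  next
    case (Suc k)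
    show ?case
    proof (cases "k < degree g")
      case True
      then show ?thesis using Suc.prems by (intro exI[of _ 0] bexI[of _ 0]) (auto simp: sp)
    next
      case False
      define m where "m = monom (coeff f k) (k - degree g)"
      have m: "m \<in> polys_over A"
        using Suc.prems(1) by (auto simp: m_def polys_over_def intro: sA)
      define f1 where "f1 = smult ?l f - g * m"
      have f1: "f1 \<in> polys_over A"
        unfolding f1_def using Suc.prems g m l A by (auto intro!: sp smult_polys_over)
      have "\<forall>i\<ge>k. coeff f1 i = 0"
      proof (intro allI impI)
        fix i assume "i \<ge> k"
        have "coeff (g * m) i = coeff f k * coeff g (i - (k - degree g))"
          using \<open>i \<ge> k\<close> by (simp add: m_def mult.commute[of g] coeff_monom_mult)
        then show "coeff f1 i = 0"
          using \<open>i \<ge> k\<close> False Suc.prems(2)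
          by (cases "i = k") (auto simp: f1_def coeff_eq_0 mult.commute)
      qed
      then obtain e h where h: "h \<in> polys_over A"
        "\<forall>i\<ge>degree g. coeff (smult (?l ^ e) f1 - g * h) i = 0"
        using Suc.IH[OF f1] by blast
      have "smult (?l ^ e) f1 - g * h = smult (?l ^ Suc e) f - g * (smult (?l ^ e) m + h)"
        by (simp add: f1_def smult_diff_right algebra_simps)
      moreover have "smult (?l ^ e) m + h \<in> polys_over A"
        using h m l A by (intro sp smult_polys_over subring_power)
      ultimately show ?thesis using h(2) by metis
    qed
  qed
  from this[of "Suc (degree f)"] show ?thesis using f by (auto simp: coeff_eq_0)
qed

section \<open>Arithmetic modulo a maximal ideal\<close>

locale max_ideal =
  fixes P :: "'a::comm_ring_1 set"
  assumes max: "maximal_ideal P"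
begin

lemma P_0: "0 \<in> P" and P_add: "a \<in> P \<Longrightarrow> b \<in> P \<Longrightarrow> a + b \<in> P"
  and P_mult: "a \<in> P \<Longrightarrow> r * a \<in> P"
  using max by (auto simp: maximal_ideal_def is_ideal_def)

lemma P_mult2: "a \<in> P \<Longrightarrow> a * r \<in> P"
  using P_mult by (metis mult.commute)

lemma P_minus: "a \<in> P \<Longrightarrow> - a \<in> P"
  using P_mult[of a "- 1"] by simp

lemma P_diff: "a \<in> P \<Longrightarrow> b \<in> P \<Longrightarrow> a - b \<in> P"
  using P_add[OF _ P_minus] by fastforce

lemma P_sum: "(\<And>i. i \<in> F \<Longrightarrow> f i \<in> P) \<Longrightarrow> sum f F \<in> P"
  by (induction F rule: infinite_finite_induct) (auto simp: P_0 P_add)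

lemma P_cong: "a - b \<in> P \<Longrightarrow> a \<in> P \<longleftrightarrow> b \<in> P"
  using P_add[of "a - b" b] P_diff[of a "a - b"] by auto

lemma one_notin_P: "1 \<notin> P"
proof
  assume "1 \<in> P"
  then have "r \<in> P" for r using P_mult[of 1 r] by simp
  then show False using max by (auto simp: maximal_ideal_def)
qed

lemma inverse_mod: assumes "a \<notin> P" obtains b where "a * b - 1 \<in> P"
proof -
  define Q where "Q = {p + r * a | p r. p \<in> P}"
  have 1: "is_ideal Q"
    unfolding is_ideal_def
  proof (intro conjI ballI allI)
    show "0 \<in> Q" unfolding Q_def by (rule CollectI, rule exI[of _ 0], rule exI[of _ 0]) (simp add: P_0)
    show "u + v \<in> Q" if uv: "u \<in> Q" "v \<in> Q" for u v
    proof -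
      obtain p r p' r' where "u = p + r * a" "v = p' + r' * a" "p \<in> P" "p' \<in> P"
        using uv by (auto simp: Q_def)
      then have "u + v = (p + p') + (r + r') * a" "p + p' \<in> P" by (auto simp: algebra_simps P_add)
      then show ?thesis unfolding Q_def by blast
    qed
    show "s * u \<in> Q" if u: "u \<in> Q" for s u
    proof -
      obtain p r where "u = p + r * a" "p \<in> P" using u by (auto simp: Q_def)
      then have "s * u = s * p + (s * r) * a" "s * p \<in> P" by (auto simp: algebra_simps P_mult P_mult2)
      then show ?thesis unfolding Q_def by blast
    qed
  qed
  have 2: "P \<subseteq> Q" unfolding Q_def
    by (force intro: exI[of _ 0])
  have "0 + 1 * a \<in> Q" unfolding Q_def using P_0 by blast
  then have "Q \<noteq> P" using assms by auto
  then have "Q = UNIV" using max 1 2 by (auto simp: maximal_ideal_def)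
  then have "1 \<in> Q" by simp
  then obtain p r where "1 = p + r * a" "p \<in> P" by (auto simp: Q_def)
  then have "a * r - 1 = - p" by (simp add: algebra_simps)
  then show ?thesis using that \<open>p \<in> P\<close> P_minus by metis
qed

lemma prime_P: "a * b \<in> P \<longleftrightarrow> a \<in> P \<or> b \<in> P"
proof
  assume ab: "a * b \<in> P"
  show "a \<in> P \<or> b \<in> P"
  proof (rule disjCI)
    assume "b \<notin> P"
    then obtain c where c: "b * c - 1 \<in> P" by (rule inverse_mod)
    have "a = a * b * c - a * (b * c - 1)" by (simp add: algebra_simps)
    then show "a \<in> P" using ab c by (metis P_diff P_mult P_mult2)
  qed
qed (auto simp: P_mult P_mult2)

lemma power_in_P: "a ^ k \<in> P \<Longrightarrow> a \<in> P"
  by (induction k) (auto simp: prime_P one_notin_P)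

lemma poly_in_P: "p \<in> polys_over P \<Longrightarrow> poly p x \<in> P"
  by (auto simp: poly_altdef polys_over_def intro!: P_sum P_mult2)

text \<open>Degrees are meaningful only over \<kappa>(P), where coefficients in \<open>P\<close>
  count as zero. Cutting off the top coefficients in \<open>P\<close> gives a representative whose
  degree survives the reduction.\<close>

lemma truncate_mod:
  assumes A: "subring A" and f: "f \<in> polys_over A" "f \<notin> polys_over P"
  obtains f' where "f' \<in> polys_over A" "lead_coeff f' \<notin> P" "f - f' \<in> polys_over P"
    "degree f' \<le> degree f"
proof -
  define k where "k = (GREATEST i. coeff f i \<notin> P)"
  have b: "\<forall>i. coeff f i \<notin> P \<longrightarrow> i \<le> degree f" using P_0 by (metis le_degree)
  obtain i where "coeff f i \<notin> P" using f(2) by (auto simp: polys_over_def)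
  then have k: "coeff f k \<notin> P" unfolding k_def using b GreatestI_nat[of "\<lambda>i. coeff f i \<notin> P" i "degree f"] by blast
  have k': "i \<le> k" if "coeff f i \<notin> P" for i
    unfolding k_def using that b Greatest_le_nat[of "\<lambda>i. coeff f i \<notin> P" i "degree f"] by blast
  define f' where "f' = poly_cutoff (Suc k) f"
  have c: "coeff f' i = (if i \<le> k then coeff f i else 0)" for i
    by (simp add: f'_def coeff_poly_cutoff less_Suc_eq_le)
  have "degree f' = k"
    using c k P_0 by (intro antisym degree_le le_degree) auto
  then show ?thesis
    using f k k' b P_0 subring_0[OF A]
    by (intro that[of f']) (auto simp: c polys_over_def)
qed

text \<open>\<open>U\<close> is the preimage of an ideal of polynomials over the image of
  \<open>A\<close> in \<kappa>(P), a domain over which ideals need not be principal. A member of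
  least degree still divides every other one up to a factor outside \<open>P\<close>: the
  pseudo-remainder lies in \<open>U\<close> and is too short to be nonzero modulo
  \<open>P\<close>.\<close>

lemma minimal_generator:
  assumes A: "subring A" and U: "U \<subseteq> polys_over A" "polys_over A \<inter> polys_over P \<subseteq> U"
    and diff: "\<And>f g. f \<in> U \<Longrightarrow> g \<in> U \<Longrightarrow> f - g \<in> U"
    and mult: "\<And>f g. f \<in> U \<Longrightarrow> g \<in> polys_over A \<Longrightarrow> f * g \<in> U"
    and nt: "\<not> U \<subseteq> polys_over P"
  shows "\<exists>g\<in>U. lead_coeff g \<notin> P \<and>
    (\<forall>f\<in>U. (\<forall>i\<ge>degree g. coeff f i = 0) \<longrightarrow> f \<in> polys_over P) \<and>
    (\<forall>f\<in>U. \<exists>c\<in>A - P. \<exists>h\<in>polys_over A. smult c f - g * h \<in> polys_over P)"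
proof -
  note sp = subringD[OF subring_polys_over[OF A]]
  have tr: "\<exists>f'\<in>U. lead_coeff f' \<notin> P \<and> f - f' \<in> polys_over P" if fU: "f \<in> U" "f \<notin> polys_over P" for f
  proof -
    have fA: "f \<in> polys_over A" using U fU by auto
    obtain f' where f': "f' \<in> polys_over A" "lead_coeff f' \<notin> P" "f - f' \<in> polys_over P"
      using truncate_mod[OF A fA fU(2)] by metis
    then have "f - f' \<in> U" using U fA sp by blast
    then have "f - (f - f') \<in> U" using diff fU by blast
    then show ?thesis using f' by auto
  qed
  define Q where "Q f \<longleftrightarrow> f \<in> U \<and> lead_coeff f \<notin> P" for f
  obtain f0 where "f0 \<in> U" "f0 \<notin> polys_over P" using nt by blast
  then obtain f1 where f1: "Q f1" using tr Q_def by blast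
  obtain g where g: "Q g" and m: "\<And>f. Q f \<Longrightarrow> degree g \<le> degree f"
    using ex_has_least_nat[of Q f1 degree, OF f1] by blast
  have small: "f \<in> polys_over P" if fU: "f \<in> U" and fs: "\<forall>i\<ge>degree g. coeff f i = 0" for f
  proof (rule ccontr)
    assume "f \<notin> polys_over P"
    then obtain f' where f': "Q f'" "f - f' \<in> polys_over P"
      using tr[OF fU] by (auto simp: Q_def)
    then have "degree g \<le> degree f'" using m by blast
    then have "coeff f (degree f') = 0" using fs by blast
    moreover have "coeff f (degree f') - lead_coeff f' \<in> P"
      using f'(2) by (auto simp: polys_over_def)
    ultimately show False using f'(1) P_minus by (force simp: Q_def)
  qed
  have gA: "g \<in> polys_over A" using g U by (auto simp: Q_def)
  show ?thesis
  proof (intro bexI[of _ g] conjI ballI impI)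
    show "g \<in> U" "lead_coeff g \<notin> P" using g by (auto simp: Q_def)
    show "\<exists>c\<in>A - P. \<exists>h\<in>polys_over A. smult c f - g * h \<in> polys_over P" if f: "f \<in> U" for f
    proof -
      have fA: "f \<in> polys_over A" using f U by auto
      obtain e h where h: "h \<in> polys_over A"
        "\<forall>i\<ge>degree g. coeff (smult (lead_coeff g ^ e) f - g * h) i = 0"
        using pseudo_division[OF A gA fA] by blast
      let ?c = "lead_coeff g ^ e"
      have c: "?c \<in> A" "?c \<notin> P"
        using gA g power_in_P by (auto simp: Q_def polys_over_def intro: subring_power[OF A])
      have "f * [:?c:] \<in> U" using f c A by (intro mult) (auto intro!: pCons_polys_over sp)
      then have "smult ?c f - g * h \<in> U" using diff mult g h by (auto simp: Q_def mult.commute)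
      from small[OF this h(2)] show ?thesis using c h by blast
    qed
  qed (use small in blast)
qed

section \<open>Zariski's lemma\<close>

text \<open>The image of \<open>A\<close> in \<open>\<kappa>(P)\<close> becomes a field after inverting a single element \<open>a\<close>.\<close>

definition almost_field :: "'a set \<Rightarrow> bool" where
  "almost_field A \<longleftrightarrow> (\<exists>a\<in>A - P. \<forall>b\<in>A - P. \<exists>c\<in>A. \<exists>k::nat. b * c - a ^ k \<in> P)"

lemma power_cong: "a - b \<in> P \<Longrightarrow> a ^ k - b ^ k \<in> P"
proof (induction k)
  case (Suc k)
  have "a ^ Suc k - b ^ Suc k = a * (a ^ k - b ^ k) + (a - b) * b ^ k"
    by (simp add: algebra_simps)
  then show ?case using Suc by (simp add: P_add P_mult P_mult2)
qed (simp add: P_0)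

lemma polys_over_P_diff: "p \<in> polys_over P \<Longrightarrow> q \<in> polys_over P \<Longrightarrow> p - q \<in> polys_over P"
  by (simp add: polys_over_def P_diff)

lemma polys_over_P_mult: "p \<in> polys_over P \<Longrightarrow> q * p \<in> polys_over P"
  by (simp add: polys_over_def coeff_mult P_sum P_mult)

lemma polys_over_P_cong: "p - q \<in> polys_over P \<Longrightarrow> p \<in> polys_over P \<longleftrightarrow> q \<in> polys_over P"
  using P_cong by (fastforce simp: polys_over_def)

lemma lead_notin: "lead_coeff p \<notin> P \<Longrightarrow> p \<notin> polys_over P"
  by (auto simp: polys_over_def)

text \<open>
  If \<open>x\<close> were transcendental modulo \<open>P\<close>, then \<open>1 + x a\<close> would divide a power of \<open>a\<close>; being coprime to
  \<open>x a\<close> it would be a unit, although it has positive degree in \<open>x\<close>.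
\<close>

lemma algebraic_of_almost_field:
  assumes A: "subring A" and af: "almost_field (adjoin A x)"
  shows "\<exists>q\<in>polys_over A. q \<notin> polys_over P \<and> poly q x \<in> P"
proof (rule ccontr)
  assume "\<not> ?thesis"
  then have trans: "q \<in> polys_over P" if "q \<in> polys_over A" "poly q x \<in> P" for q
    using that by blast
  have spA: "subring (polys_over A)" by (rule subring_polys_over[OF A])
  note sp = subringD[OF spA]
  obtain a where a: "a \<in> adjoin A x" "a \<notin> P"
    and af': "\<forall>b\<in>adjoin A x - P. \<exists>c\<in>adjoin A x. \<exists>k::nat. b * c - a ^ k \<in> P"
    using af by (auto simp: almost_field_def)
  obtain \<alpha>0 where \<alpha>0: "\<alpha>0 \<in> polys_over A" "a = poly \<alpha>0 x"
    using a by (auto simp: adjoin_def)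
  have "\<alpha>0 \<notin> polys_over P" using \<alpha>0 a poly_in_P by blast
  then obtain \<alpha> where \<alpha>: "\<alpha> \<in> polys_over A" "lead_coeff \<alpha> \<notin> P" "\<alpha>0 - \<alpha> \<in> polys_over P"
    using truncate_mod[OF A \<alpha>0(1)] by metis
  have \<alpha>_cong: "a - poly \<alpha> x \<in> P" using poly_in_P[OF \<alpha>(3), of x] \<alpha>0 by simp
  have \<alpha>nz: "\<alpha> \<noteq> 0" using \<alpha>(2) P_0 by auto
  define X where "X = [:0, 1::'a:]"
  have X: "X \<in> polys_over A"
    by (auto simp: X_def intro!: pCons_polys_over A sp subring_0[OF A] subring_1[OF A])
  define \<beta> where "\<beta> = 1 + X * \<alpha>"
  have \<beta>A: "\<beta> \<in> polys_over A" by (auto simp: \<beta>_def intro!: sp X \<alpha>)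
  have \<beta>_eq: "\<beta> = pCons 1 \<alpha>" by (simp add: \<beta>_def X_def one_pCons)
  have \<beta>: "degree \<beta> = Suc (degree \<alpha>)" "lead_coeff \<beta> = lead_coeff \<alpha>"
    using \<alpha>nz by (simp_all add: \<beta>_eq)
  have "poly \<beta> x \<notin> P" using trans[OF \<beta>A] lead_notin \<alpha>(2) \<beta>(2) by metis
  moreover have "poly \<beta> x \<in> adjoin A x" using \<beta>A by (auto simp: adjoin_def)
  ultimately obtain c k where c: "c \<in> adjoin A x" "poly \<beta> x * c - a ^ k \<in> P"
    using af' by blast
  then obtain \<gamma> where \<gamma>: "\<gamma> \<in> polys_over A" "poly \<beta> x * poly \<gamma> x - a ^ k \<in> P"
    by (auto simp: adjoin_def)
  \<comment> \<open>Every power of \<open>1 - \<beta>\<close> is congruent to 1 modulo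
    \<open>\<beta>\<close>.\<close>
  have "\<exists>\<delta>\<in>polys_over A. (1 - \<beta>) ^ k = 1 - \<beta> * \<delta>"
  proof (induction k)
    case (Suc k)
    then obtain \<delta> where "\<delta> \<in> polys_over A" "(1 - \<beta>) ^ k = 1 - \<beta> * \<delta>" by blast
    then have "(1 - \<beta>) ^ Suc k = (1 - \<beta>) * (1 - \<beta> * \<delta>)" by simp
    then have "(1 - \<beta>) ^ Suc k = 1 - \<beta> * (1 + \<delta> - \<beta> * \<delta>)" by (simp add: algebra_simps)
    moreover have "1 + \<delta> - \<beta> * \<delta> \<in> polys_over A" by (intro sp \<beta>A \<open>\<delta> \<in> polys_over A\<close>)
    ultimately show ?case by blast
  qed (auto intro!: bexI[of _ 0] sp)
  then obtain \<delta> where \<delta>: "\<delta> \<in> polys_over A" "(1 - \<beta>) ^ k = 1 - \<beta> * \<delta>" by blast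
  \<comment> \<open>At \<open>x\<close>, \<open>\<beta> * \<gamma>\<close> is congruent to the
    \<open>k\<close>-th power of \<open>\<alpha>\<close>. Multiplying by \<open>(- X) ^ k\<close>
    yields \<open>(1 - \<beta>) ^ k = 1 - \<beta> * \<delta>\<close>, so \<open>\<epsilon>\<close>
    inverts \<open>\<beta>\<close> at \<open>x\<close>. Transcendence then lifts this congruence to
    all coefficients.\<close>
  define \<epsilon> where "\<epsilon> = \<gamma> * (0 - X) ^ k + \<delta>"
  have \<epsilon>A: "\<epsilon> \<in> polys_over A"
    by (auto simp only: \<epsilon>_def intro!: sp \<gamma> \<delta> X subring_power[OF spA])
  have "(- x) ^ k * (poly \<beta> x * poly \<gamma> x - a ^ k) + (- x) ^ k * (a ^ k - poly \<alpha> x ^ k) \<in> P"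
    by (intro P_add P_mult \<gamma> power_cong \<alpha>_cong)
  moreover have "poly ((1 - \<beta>) ^ k) x = (- x) ^ k * poly \<alpha> x ^ k"
    by (simp add: \<beta>_def X_def flip: power_mult_distrib)
  then have "poly (\<beta> * \<epsilon> - 1) x
    = (- x) ^ k * (poly \<beta> x * poly \<gamma> x - a ^ k) + (- x) ^ k * (a ^ k - poly \<alpha> x ^ k)"
    unfolding \<delta>(2) by (simp add: \<epsilon>_def X_def algebra_simps)
  ultimately have 1: "\<beta> * \<epsilon> - 1 \<in> polys_over P"
    by (intro trans) (auto intro!: sp \<beta>A \<epsilon>A)
  have 2: "1 \<notin> polys_over P" using one_notin_P by (intro lead_notin) simp
  have "\<epsilon> \<notin> polys_over P" using 1 2 polys_over_P_mult polys_over_P_cong by blast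
  then obtain \<epsilon>' where \<epsilon>': "\<epsilon>' \<in> polys_over A" "lead_coeff \<epsilon>' \<notin> P" "\<epsilon> - \<epsilon>' \<in> polys_over P"
    using truncate_mod[OF A \<epsilon>A] by metis
  have "(\<beta> * \<epsilon> - 1) - \<beta> * (\<epsilon> - \<epsilon>') \<in> polys_over P"
    by (intro polys_over_P_diff polys_over_P_mult 1 \<epsilon>')
  then have "\<beta> * \<epsilon>' - 1 \<in> polys_over P" by (simp add: algebra_simps)
  then have "coeff (\<beta> * \<epsilon>' - 1) (degree \<beta> + degree \<epsilon>') \<in> P" unfolding polys_over_def by blast
  moreover have "coeff (1 :: 'a poly) (degree \<beta> + degree \<epsilon>') = 0" using \<beta>(1) by simp
  then have "coeff (\<beta> * \<epsilon>' - 1) (degree \<beta> + degree \<epsilon>') = lead_coeff \<beta> * lead_coeff \<epsilon>'"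
    by (simp only: coeff_diff coeff_mult_degree_sum diff_zero)
  ultimately have "lead_coeff \<beta> * lead_coeff \<epsilon>' \<in> P" by simp
  then show False using \<alpha>(2) \<beta>(2) \<epsilon>'(2) by (simp add: prime_P)
qed

text \<open>Both closing properties are used separately: minimality of the degree gives separability
  and allows coefficients to be compared, while divisibility up to factors outside \<open>P\<close>
  shows that the new parameters generate \<open>P\<close> locally.\<close>

lemma minimal_polynomial:
  assumes A: "subring A" and alg: "\<exists>q\<in>polys_over A. q \<notin> polys_over P \<and> poly q x \<in> P"
  obtains q where "q \<in> polys_over A" "poly q x \<in> P" "lead_coeff q \<notin> P" "degree q > 0"
    "\<And>f. f \<in> polys_over A \<Longrightarrow> poly f x \<in> P \<Longrightarrow> \<forall>i\<ge>degree q. coeff f i = 0 \<Longrightarrow> f \<in> polys_over P"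
    "\<And>f. f \<in> polys_over A \<Longrightarrow> poly f x \<in> P \<Longrightarrow>
       \<exists>c\<in>A - P. \<exists>h\<in>polys_over A. smult c f - q * h \<in> polys_over P"
proof -
  note sp = subringD[OF subring_polys_over[OF A]]
  define U where "U = {f\<in>polys_over A. poly f x \<in> P}"
  have U: "f \<in> U \<longleftrightarrow> f \<in> polys_over A \<and> poly f x \<in> P" for f by (simp add: U_def)
  have U1: "U \<subseteq> polys_over A" and U2: "polys_over A \<inter> polys_over P \<subseteq> U"
    and U3: "\<not> U \<subseteq> polys_over P"
    using poly_in_P alg by (auto simp: U_def)
  have U4: "f - g \<in> U" if "f \<in> U" "g \<in> U" for f g
    using that by (simp add: U sp P_diff)
  have U5: "f * g \<in> U" if "f \<in> U" "g \<in> polys_over A" for f g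
    using that by (simp add: U sp P_mult2)
  obtain q where q: "q \<in> U" "lead_coeff q \<notin> P"
    "\<And>f. f \<in> U \<Longrightarrow> \<forall>i\<ge>degree q. coeff f i = 0 \<Longrightarrow> f \<in> polys_over P"
    "\<And>f. f \<in> U \<Longrightarrow> \<exists>c\<in>A - P. \<exists>h\<in>polys_over A. smult c f - q * h \<in> polys_over P"
    using minimal_generator[OF A U1 U2 U4 U5 U3] by blast
  have "degree q > 0"
  proof (rule ccontr)
    assume "\<not> degree q > 0"
    then have "poly q x = lead_coeff q" by (auto simp: poly_altdef)
    then show False using q by (auto simp: U)
  qed
  then show ?thesis using q that unfolding U by metis
qed

text \<open>
  The element to invert is \<open>l e\<close>, where \<open>l\<close> is the leading coefficient of a minimal polynomial of \<open>x\<close> and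
  \<open>e \<in> A\<close> is a multiple of \<open>a\<close>. An inverse of \<open>b \<in> A\<close> is a polynomial in \<open>x\<close> of degree less than that
  of the minimal polynomial, so comparing constant coefficients shows that it lies in \<open>A\<close>.
\<close>

lemma almost_field_descend:
  assumes A: "subring A" and af: "almost_field (adjoin A x)"
  shows "almost_field A"
proof -
  have spA: "subring (polys_over A)" by (rule subring_polys_over[OF A])
  have sB: "subring (adjoin A x)" by (rule subring_adjoin[OF A])
  note sp = subringD[OF spA] and sB' = subringD[OF sB] and sA = subringD[OF A]
  obtain a where a: "a \<in> adjoin A x" "a \<notin> P"
    and af': "\<forall>b\<in>adjoin A x - P. \<exists>c\<in>adjoin A x. \<exists>k::nat. b * c - a ^ k \<in> P"
    using af by (auto simp: almost_field_def)
  obtain \<alpha> where \<alpha>: "\<alpha> \<in> polys_over A" "a = poly \<alpha> x"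
    using a by (auto simp: adjoin_def)
  have \<alpha>P: "\<alpha> \<notin> polys_over P" using \<alpha> a poly_in_P by blast
  obtain q where q: "q \<in> polys_over A" "poly q x \<in> P" "lead_coeff q \<notin> P" "degree q > 0"
    and q_min: "\<And>f. f \<in> polys_over A \<Longrightarrow> poly f x \<in> P \<Longrightarrow> \<forall>i\<ge>degree q. coeff f i = 0 \<Longrightarrow> f \<in> polys_over P"
    using minimal_polynomial[OF A algebraic_of_almost_field[OF A af]] by metis
  let ?d = "degree q" and ?l = "lead_coeff q"
  have lA: "?l \<in> A" using q by (auto simp: polys_over_def)
  \<comment> \<open>The preimage of the principal ideal generated by \<open>a\<close> in
    \<open>A[x]\<close> modulo \<open>P\<close>. Its generator \<open>g\<close> turns out to be
    constant, and this constant is the required multiple \<open>e\<close> of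
    \<open>a\<close>.\<close>
  define U where "U = {f\<in>polys_over A. \<exists>y\<in>adjoin A x. poly f x - a * y \<in> P}"
  have U_I: "f \<in> U" if "f \<in> polys_over A" "y \<in> adjoin A x" "poly f x - a * y \<in> P" for f y
    using that by (auto simp: U_def)
  have U_diff: "f - g \<in> U" if fg: "f \<in> U" "g \<in> U" for f g
  proof -
    obtain y z where yz: "y \<in> adjoin A x" "z \<in> adjoin A x" "poly f x - a * y \<in> P" "poly g x - a * z \<in> P"
      using fg by (auto simp: U_def)
    have "(poly f x - a * y) - (poly g x - a * z) \<in> P" using yz P_diff by blast
    then have "poly (f - g) x - a * (y - z) \<in> P" by (simp add: algebra_simps)
    then show ?thesis using fg yz by (intro U_I[of _ "y - z"]) (simp_all add: U_def sp sB')
  qed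
  have U_mult: "f * g \<in> U" if fg: "f \<in> U" "g \<in> polys_over A" for f g
  proof -
    obtain y where y: "y \<in> adjoin A x" "poly f x - a * y \<in> P"
      using fg by (auto simp: U_def)
    have "(poly f x - a * y) * poly g x \<in> P" using y P_mult2 by blast
    then have "poly (f * g) x - a * (y * poly g x) \<in> P" by (simp add: algebra_simps)
    moreover have "poly g x \<in> adjoin A x" using fg by (auto simp: adjoin_def)
    ultimately show ?thesis
      using fg y by (intro U_I[of _ "y * poly g x"]) (simp_all add: U_def sp sB')
  qed
  have U_P: "f \<in> U" if "f \<in> polys_over A" "poly f x \<in> P" for f
    using that by (intro U_I[of _ 0]) (auto simp: sB')
  have \<alpha>U: "\<alpha> \<in> U" using \<alpha> by (intro U_I[of _ 1]) (auto simp: sB' P_0)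
  have U1: "U \<subseteq> polys_over A" by (auto simp: U_def)
  have U2: "polys_over A \<inter> polys_over P \<subseteq> U" using U_P poly_in_P by blast
  have U3: "\<not> U \<subseteq> polys_over P" using \<alpha>U \<alpha>P by blast
  obtain g where g: "g \<in> U" "lead_coeff g \<notin> P"
    and g_min: "\<And>f. f \<in> U \<Longrightarrow> \<forall>i\<ge>degree g. coeff f i = 0 \<Longrightarrow> f \<in> polys_over P"
    and g_dvd: "\<And>f. f \<in> U \<Longrightarrow> \<exists>c\<in>A - P. \<exists>h\<in>polys_over A. smult c f - g * h \<in> polys_over P"
    using minimal_generator[OF A U1 U2 U_diff U_mult U3] by blast
  have gA: "g \<in> polys_over A" using g by (auto simp: U_def)
  have qU: "q \<in> U" using U_P q by blast
  have "degree g \<le> ?d"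
  proof (rule ccontr)
    assume "\<not> degree g \<le> ?d"
    then have "q \<in> polys_over P" using qU by (intro g_min) (auto simp: coeff_eq_0)
    then show False using q lead_notin by blast
  qed
  \<comment> \<open>If \<open>U\<close> had no member of degree below \<open>?d\<close> modulo
    \<open>P\<close>, the pseudo-remainder of \<open>\<alpha>\<close> by \<open>q\<close> would
    vanish there, and evaluation at \<open>x\<close> would put a power of \<open>?l\<close> times
    \<open>a\<close> into \<open>P\<close>.\<close>
  moreover have "degree g \<noteq> ?d"
  proof
    assume eq: "degree g = ?d"
    obtain e h where h: "h \<in> polys_over A" "\<forall>i\<ge>?d. coeff (smult (?l ^ e) \<alpha> - q * h) i = 0"
      using pseudo_division[OF A q(1) \<alpha>(1)] by blast
    have "\<alpha> * [:?l ^ e:] \<in> U"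
      by (intro U_mult \<alpha>U pCons_polys_over A sp subring_power lA)
    then have "smult (?l ^ e) \<alpha> - q * h \<in> U" using U_diff[OF _ U_mult[OF qU h(1)]] by simp
    then have "smult (?l ^ e) \<alpha> - q * h \<in> polys_over P" using h eq by (intro g_min) auto
    then have "poly (smult (?l ^ e) \<alpha> - q * h) x \<in> P" by (rule poly_in_P)
    then have "?l ^ e * a - poly q x * poly h x \<in> P" by (simp add: \<alpha>)
    then have "?l ^ e * a \<in> P" using P_cong P_mult2[OF q(2)] by blast
    then show False using a(2) q(3) power_in_P prime_P by blast
  qed
  ultimately have dg: "degree g < ?d" by simp
  \<comment> \<open>Up to a factor \<open>c\<close>, \<open>q\<close> is congruent to
    \<open>g * h\<close>. By minimality of \<open>q\<close> the value of \<open>g\<close> at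
    \<open>x\<close> is outside \<open>P\<close>, so that of \<open>h\<close> is in
    \<open>P\<close>. For \<open>g\<close> of positive degree, \<open>h\<close> is shorter than
    \<open>q\<close> modulo \<open>P\<close>, which contradicts minimality again.\<close>
  have dg0: "degree g = 0"
  proof (rule ccontr)
    assume dgp: "degree g \<noteq> 0"
    obtain c h where h: "c \<in> A" "c \<notin> P" "h \<in> polys_over A" "smult c q - g * h \<in> polys_over P"
      using g_dvd[OF qU] by blast
    have "c * poly q x - poly g x * poly h x \<in> P" using poly_in_P[OF h(4), of x] by simp
    then have "poly g x * poly h x \<in> P" using P_cong P_mult[OF q(2)] by blast
    moreover have "poly g x \<notin> P"
      using q_min[OF gA] dg lead_notin g(2) by (auto simp: coeff_eq_0)
    ultimately have hx: "poly h x \<in> P" by (simp add: prime_P)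
    have cq: "smult c q \<notin> polys_over P" using q h by (auto simp: polys_over_def prime_P)
    have "h \<notin> polys_over P"
      using cq h(4) polys_over_P_mult polys_over_P_cong by blast
    then obtain h' where h': "h' \<in> polys_over A" "lead_coeff h' \<notin> P" "h - h' \<in> polys_over P"
      using truncate_mod[OF A h(3)] by metis
    have "poly h x - poly h' x \<in> P" using poly_in_P[OF h'(3), of x] by simp
    then have h'x: "poly h' x \<in> P" using hx P_cong by blast
    have "(smult c q - g * h) - (- g) * (h - h') \<in> polys_over P"
      by (intro polys_over_P_diff polys_over_P_mult h h')
    then have "smult c q - g * h' \<in> polys_over P" by (simp add: algebra_simps)
    then have "coeff (smult c q - g * h') (degree g + degree h') \<in> P" unfolding polys_over_def by blast
    then have "c * coeff q (degree g + degree h') - lead_coeff g * lead_coeff h' \<in> P"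
      by (simp add: coeff_mult_degree_sum)
    moreover have "lead_coeff g * lead_coeff h' \<notin> P" using g h' by (simp add: prime_P)
    ultimately have "c * coeff q (degree g + degree h') \<notin> P" using P_cong by blast
    then have "degree g + degree h' \<le> ?d" using P_0 by (metis coeff_eq_0 mult_zero_right not_le)
    then have "h' \<in> polys_over P"
      using dgp by (intro q_min h' h'x) (auto simp: coeff_eq_0)
    then show False using h'(2) lead_notin by blast
  qed
  define e where "e = lead_coeff g"
  have e: "e \<in> A" "e \<notin> P" "poly g x = e"
    using g gA dg0 by (auto simp: e_def polys_over_def poly_altdef)
  obtain a' where a': "a' \<in> adjoin A x" "e - a * a' \<in> P" using g e by (auto simp: U_def)
  have "\<exists>c\<in>A. \<exists>k. b * c - (?l * e) ^ k \<in> P" if b: "b \<in> A - P" for b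
  proof -
    obtain c k where c: "c \<in> adjoin A x" "b * c - a ^ k \<in> P"
      using af' b adjoin_base[OF A] by blast
    \<comment> \<open>As \<open>e\<close> is congruent to \<open>a * a'\<close>, this factor turns
      \<open>b * c \<equiv> a ^ k\<close> into a relation whose right-hand side \<open>e ^ k\<close>
      lies in \<open>A\<close>.\<close>
    have "c * a' ^ k \<in> adjoin A x" by (intro sB' c a' subring_power[OF sB])
    then obtain \<eta> where \<eta>: "\<eta> \<in> polys_over A" "c * a' ^ k = poly \<eta> x" by (auto simp: adjoin_def)
    obtain N h where h: "h \<in> polys_over A" "\<forall>i\<ge>?d. coeff (smult (?l ^ N) \<eta> - q * h) i = 0"
      using pseudo_division[OF A q(1) \<eta>(1)] by blast
    define r where "r = smult (?l ^ N) \<eta> - q * h"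
    have r: "r \<in> polys_over A" "\<forall>i\<ge>?d. coeff r i = 0"
      using h by (auto simp: r_def intro!: sp q \<eta> smult_polys_over[OF A] subring_power[OF A] lA)
    define f where "f = smult b r - [:?l ^ N * e ^ k:]"
    have "poly f x = ?l ^ N * (a' ^ k * (b * c - a ^ k)) - ?l ^ N * (e ^ k - (a * a') ^ k)
        - poly q x * (b * poly h x)"
      by (simp add: f_def r_def algebra_simps power_mult_distrib flip: \<eta>(2))
    also have "\<dots> \<in> P"
      by (intro P_diff P_mult c power_cong a' P_mult2[OF q(2)])
    finally have "f \<in> polys_over P"
      using r b q(4)
      by (intro q_min) (auto simp: f_def coeff_pCons split: nat.splits
            intro!: sp pCons_polys_over smult_polys_over A sA subring_power[OF A] lA e)
    then have "coeff f 0 \<in> P" by (simp add: polys_over_def)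
    then have "b * coeff r 0 - ?l ^ N * e ^ k \<in> P" by (simp add: f_def)
    \<comment> \<open>Equalises the exponents, since \<open>almost_field\<close> asks for a power of
      the single element \<open>?l * e\<close>.\<close>
    then have "?l ^ k * e ^ N * (b * coeff r 0 - ?l ^ N * e ^ k) \<in> P" by (rule P_mult)
    then have "b * (coeff r 0 * (?l ^ k * e ^ N)) - (?l * e) ^ (N + k) \<in> P"
      by (simp add: algebra_simps power_mult_distrib power_add)
    moreover have "coeff r 0 * (?l ^ k * e ^ N) \<in> A"
      using r by (intro sA subring_power[OF A] lA e) (auto simp: polys_over_def)
    ultimately show ?thesis by blast
  qed
  then show ?thesis
    using e q lA unfolding almost_field_def
    by (intro bexI[of _ "?l * e"]) (auto simp: prime_P intro: sA)
qed

end

section \<open>Partial derivatives\<close>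

definition unit_index :: "'n \<Rightarrow> 'n \<Rightarrow>\<^sub>0 nat" where
  "unit_index i = Poly_Mapping.single i 1"

lemma lookup_unit_index: "Poly_Mapping.lookup (unit_index i) j = (if i = j then 1 else 0)"
  by (simp add: unit_index_def lookup_single when_def)

definition index_deg :: "('n::finite \<Rightarrow>\<^sub>0 nat) \<Rightarrow> nat" where
  "index_deg \<alpha> = (\<Sum>i\<in>UNIV. Poly_Mapping.lookup \<alpha> i)"

lemma index_deg_0 [simp]: "index_deg 0 = 0"
  by (simp add: index_deg_def)

lemma index_deg_add: "index_deg (\<alpha> + \<beta>) = index_deg \<alpha> + index_deg \<beta>"
  by (simp add: index_deg_def lookup_add sum.distrib)

lemma index_deg_unit [simp]: "index_deg (unit_index i) = 1"
  by (simp add: index_deg_def lookup_unit_index)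

lemma index_minus_unit:
  assumes "Poly_Mapping.lookup \<alpha> i > 0"
  shows "\<alpha> - unit_index i + unit_index i = \<alpha>"
  using assms
  by (intro poly_mapping_eqI) (auto simp: lookup_add lookup_minus lookup_unit_index)

lemma index_deg_eq_0: "index_deg \<alpha> = 0 \<Longrightarrow> \<alpha> = 0"
  by (intro poly_mapping_eqI) (simp add: index_deg_def)

lemma index_deg_Suc:
  assumes "index_deg \<alpha> = Suc m"
  obtains \<beta> i where "\<alpha> = \<beta> + unit_index i" "index_deg \<beta> = m"
proof -
  have "\<exists>i. Poly_Mapping.lookup \<alpha> i > 0"
  proof (rule ccontr)
    assume "\<not> ?thesis"
    then have "index_deg \<alpha> = 0" by (simp add: index_deg_def)
    then show False using assms by simp
  qed
  then obtain i where "Poly_Mapping.lookup \<alpha> i > 0" by blast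
  note eq = index_minus_unit[OF this]
  show ?thesis
  proof (rule that)
    show "\<alpha> = \<alpha> - unit_index i + unit_index i" by (rule eq[symmetric])
    show "index_deg (\<alpha> - unit_index i) = m"
      using assms index_deg_add[of "\<alpha> - unit_index i" "unit_index i"] by (simp add: eq)
  qed
qed

lemma finite_index_deg: "finite {\<alpha> :: 'n::finite \<Rightarrow>\<^sub>0 nat. index_deg \<alpha> = m}"
proof (induction m)
  case 0
  have "{\<alpha> :: 'n \<Rightarrow>\<^sub>0 nat. index_deg \<alpha> = 0} \<subseteq> {0}" using index_deg_eq_0 by blast
  then show ?case by (rule finite_subset) simp
next
  case (Suc m)
  have "{\<alpha> :: 'n \<Rightarrow>\<^sub>0 nat. index_deg \<alpha> = Suc m}
      \<subseteq> (\<Union>i. (\<lambda>\<beta>. \<beta> + unit_index i) ` {\<beta>. index_deg \<beta> = m})"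
  proof
    fix \<alpha> :: "'n \<Rightarrow>\<^sub>0 nat" assume "\<alpha> \<in> {\<alpha>. index_deg \<alpha> = Suc m}"
    then obtain \<beta> i where "\<alpha> = \<beta> + unit_index i" "index_deg \<beta> = m"
      using index_deg_Suc[of \<alpha> m] by auto
    then show "\<alpha> \<in> (\<Union>i. (\<lambda>\<beta>. \<beta> + unit_index i) ` {\<beta>. index_deg \<beta> = m})" by auto
  qed
  then show ?case by (rule finite_subset) (simp add: Suc)
qed

lemma finite_index_deg_less: "finite {\<alpha> :: 'n::finite \<Rightarrow>\<^sub>0 nat. index_deg \<alpha> < m}"
proof -
  have "{\<alpha> :: 'n \<Rightarrow>\<^sub>0 nat. index_deg \<alpha> < m} = (\<Union>k<m. {\<alpha>. index_deg \<alpha> = k})" by auto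
  then show ?thesis by (simp add: finite_index_deg)
qed

lemma diff_coeff_0: "diff_coeff 0 \<beta> = 1"
  by (simp add: diff_coeff_def)

text \<open>The recursion \<open>(b+1)!/(b-a)! = (b+1) * b!/(b-a)!\<close> in coordinate
  \<open>i\<close>. If the exponent of \<open>i\<close> is 0, both sides vanish, so the truncated
  subtraction does no harm.\<close>

lemma diff_coeff_add_unit:
  "diff_coeff (\<alpha> + unit_index i) \<beta> = Poly_Mapping.lookup \<beta> i * diff_coeff \<alpha> (\<beta> - unit_index i)"
proof (cases "Poly_Mapping.lookup \<beta> i")
  case 0
  then have n: "\<not> (\<forall>j. Poly_Mapping.lookup (\<alpha> + unit_index i) j \<le> Poly_Mapping.lookup \<beta> j)"
    by (auto simp: lookup_add lookup_unit_index intro!: exI[of _ i])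
  show ?thesis unfolding diff_coeff_def if_not_P[OF n] using 0 by simp
next
  case (Suc b)
  let ?a = "Poly_Mapping.lookup \<alpha>" and ?b = "Poly_Mapping.lookup \<beta>"
  let ?a' = "Poly_Mapping.lookup (\<alpha> + unit_index i)" and ?b' = "Poly_Mapping.lookup (\<beta> - unit_index i)"
  have l: "?a' j = (if j = i then Suc (?a i) else ?a j)" "?b' j = (if j = i then b else ?b j)" for j
    using Suc by (auto simp: lookup_add lookup_minus lookup_unit_index)
  have c: "(\<forall>j. ?a' j \<le> ?b j) \<longleftrightarrow> (\<forall>j. ?a j \<le> ?b' j)"
    unfolding l by (metis Suc Suc_le_mono)
  show ?thesis
  proof (cases "\<forall>j. ?a j \<le> ?b' j")
    case True
    have "fact (Suc b) div fact (Suc b - Suc (?a i)) = Suc b * (fact b div fact (b - ?a i))"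
      by (simp add: div_mult_swap fact_dvd)
    moreover have "(\<Prod>j\<in>UNIV - {i}. fact (?b j) div fact (?b j - ?a' j) :: nat)
        = (\<Prod>j\<in>UNIV - {i}. fact (?b' j) div fact (?b' j - ?a j))"
      by (intro prod.cong) (auto simp: l)
    ultimately have "(\<Prod>j\<in>UNIV. fact (?b j) div fact (?b j - ?a' j) :: nat)
        = Suc b * (\<Prod>j\<in>UNIV. fact (?b' j) div fact (?b' j - ?a j))"
      by (subst (1 2) prod.remove[of _ i]) (simp_all only: l Suc finite UNIV_I simp_thms if_True mult.assoc)
    then show ?thesis using True c Suc by (simp add: diff_coeff_def)
  next
    case False
    then have "\<not> (\<forall>j. ?a' j \<le> ?b j)" using c by blast
    then show ?thesis using False by (simp only: diff_coeff_def if_False mult_0_right)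
  qed
qed

lemma diff_coeff_unit: "diff_coeff (unit_index i) \<beta> = Poly_Mapping.lookup \<beta> i"
  using diff_coeff_add_unit[of 0 i \<beta>] by (simp add: diff_coeff_0)

section \<open>Additivity, composition and product rule of the derivatives\<close>

lemma pdiff_superset:
  assumes "finite S" "Poly_Mapping.keys p \<subseteq> S"
  shows "pdiff \<alpha> p = (\<Sum>\<beta>\<in>S. Poly_Mapping.single (\<beta> - \<alpha>) (of_nat (diff_coeff \<alpha> \<beta>) * Poly_Mapping.lookup p \<beta>))"
  unfolding pdiff_def using assms by (intro sum.mono_neutral_left) (auto simp: in_keys_iff)

lemma pdiff_add: "pdiff \<alpha> (p + q) = pdiff \<alpha> p + pdiff \<alpha> q"
proof -
  let ?S = "Poly_Mapping.keys p \<union> Poly_Mapping.keys q"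
  show ?thesis
    using Poly_Mapping.keys_add[of p q]
    by (simp add: pdiff_superset[of ?S] lookup_add algebra_simps single_add sum.distrib)
qed

lemma pdiff_0 [simp]: "pdiff \<alpha> 0 = 0"
  by (simp add: pdiff_def)

lemma pdiff_minus: "pdiff \<alpha> (- p) = - pdiff \<alpha> p"
  using pdiff_add[of \<alpha> p "- p"] by (simp add: eq_neg_iff_add_eq_0 add.commute)

lemma pdiff_diff: "pdiff \<alpha> (p - q) = pdiff \<alpha> p - pdiff \<alpha> q"
  using pdiff_add[of \<alpha> p "- q"] by (simp add: pdiff_minus)

lemma pdiff_sum: "pdiff \<alpha> (sum f A) = (\<Sum>i\<in>A. pdiff \<alpha> (f i))"
  by (induction A rule: infinite_finite_induct) (auto simp: pdiff_add)

lemma pdiff_single: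
  "pdiff \<alpha> (Poly_Mapping.single \<beta> c) = Poly_Mapping.single (\<beta> - \<alpha>) (of_nat (diff_coeff \<alpha> \<beta>) * c)"
  by (simp add: pdiff_superset[of "{\<beta>}"])

lemma single_add_induct [case_names single add]:
  assumes single: "\<And>a b. P (Poly_Mapping.single a b)" and add: "\<And>p q. P p \<Longrightarrow> P q \<Longrightarrow> P (p + q)"
  shows "P p"
proof (induction p rule: Poly_Mapping.update_induct)
  case const
  then show ?case using single[of undefined 0] by simp
next
  case (update f a b)
  have "Poly_Mapping.update a b f = f + Poly_Mapping.single a b"
    using update(1)
    by (intro poly_mapping_eqI)
      (auto simp: lookup_update lookup_add lookup_single in_keys_iff when_def)
  then show ?case using update add single by simp
qed

lemma additive_eqI:
  fixes F G :: "('a \<Rightarrow>\<^sub>0 'b::comm_monoid_add) \<Rightarrow> 'c::comm_monoid_add"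
  assumes "\<And>p q. F (p + q) = F p + F q" "\<And>p q. G (p + q) = G p + G q"
    and "\<And>\<beta> c. F (Poly_Mapping.single \<beta> c) = G (Poly_Mapping.single \<beta> c)"
  shows "F p = G p"
  by (induction p rule: single_add_induct) (simp_all add: assms)

lemma pdiff_index_0 [simp]: "pdiff 0 p = p"
  by (rule additive_eqI[of "pdiff 0" "\<lambda>p. p"]) (simp_all add: pdiff_add pdiff_single diff_coeff_0)

abbreviation partial :: "'n::finite \<Rightarrow> ('n, 'k::comm_ring_1) mpoly \<Rightarrow> ('n, 'k) mpoly" where
  "partial i \<equiv> pdiff (unit_index i)"

text \<open>Lets statements about higher derivatives be proved by splitting off one first-order
  derivative at a time.\<close>

lemma pdiff_add_unit: "pdiff (\<alpha> + unit_index i) p = pdiff \<alpha> (partial i p)"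
  by (rule additive_eqI[of "pdiff (\<alpha> + unit_index i)" "\<lambda>p. pdiff \<alpha> (partial i p)"])
    (simp_all add: pdiff_add pdiff_single diff_coeff_add_unit diff_coeff_unit
      diff_diff_eq add.commute mult.assoc mult.left_commute)

lemma partial_mult: "partial i (p * q) = partial i p * q + p * partial i q"
proof -
  have *: "partial i (Poly_Mapping.single \<beta> c * Poly_Mapping.single \<gamma> d) =
      partial i (Poly_Mapping.single \<beta> c) * Poly_Mapping.single \<gamma> d +
      Poly_Mapping.single \<beta> c * partial i (Poly_Mapping.single \<gamma> d)"
    for \<beta> \<gamma> :: "'a \<Rightarrow>\<^sub>0 nat" and c d :: 'b
  proof -
    let ?b = "Poly_Mapping.lookup \<beta> i" and ?c = "Poly_Mapping.lookup \<gamma> i"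
    let ?e = "unit_index i"
    \<comment> \<open>Truncated subtraction and addition of exponents commute only if the exponent
      of \<open>i\<close> is positive; otherwise the coefficient is 0 on both sides. The same holds
      for the second factor.\<close>
    have 1: "Poly_Mapping.single (\<beta> - ?e + \<gamma>) (of_nat ?b * c * d)
        = Poly_Mapping.single (\<beta> + \<gamma> - ?e) (of_nat ?b * c * d)"
    proof (cases "?b = 0")
      case False
      then have "\<beta> - ?e + \<gamma> = \<beta> + \<gamma> - ?e"
        by (intro poly_mapping_eqI) (auto simp: lookup_add lookup_minus lookup_unit_index)
      then show ?thesis by simp
    qed simp
    have 2: "Poly_Mapping.single (\<beta> + (\<gamma> - ?e)) (of_nat ?c * c * d)
        = Poly_Mapping.single (\<beta> + \<gamma> - ?e) (of_nat ?c * c * d)"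
    proof (cases "?c = 0")
      case False
      then have "\<beta> + (\<gamma> - ?e) = \<beta> + \<gamma> - ?e"
        by (intro poly_mapping_eqI) (auto simp: lookup_add lookup_minus lookup_unit_index)
      then show ?thesis by simp
    qed simp
    show ?thesis using 1 2
      by (simp add: mult_single pdiff_single diff_coeff_unit lookup_add algebra_simps single_add)
  qed
  have **: "partial i (Poly_Mapping.single \<beta> c * q) =
      partial i (Poly_Mapping.single \<beta> c) * q + Poly_Mapping.single \<beta> c * partial i q"
    for \<beta> :: "'a \<Rightarrow>\<^sub>0 nat" and c :: 'b and q
  proof (induction q rule: single_add_induct)
    case (single \<gamma> d)
    then show ?case by (rule * )
  next
    case (add q r)
    then show ?case by (simp only: distrib_left pdiff_add add_ac)
  qed
  show ?thesis
  proof (induction p rule: single_add_induct)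
    case (single \<gamma> d)
    then show ?case by (rule ** )
  next
    case (add p r)
    then show ?case by (simp only: distrib_right pdiff_add add_ac)
  qed
qed

section \<open>Polynomials in a subset of the variables\<close>

definition Var :: "'n \<Rightarrow> ('n, 'k::comm_ring_1) mpoly" where
  "Var i = Poly_Mapping.single (unit_index i) 1"

definition Const :: "'k \<Rightarrow> ('n, 'k::comm_ring_1) mpoly" where
  "Const c = Poly_Mapping.single 0 c"

lemma partial_Const [simp]: "partial i (Const c) = 0"
  by (simp add: Const_def pdiff_single diff_coeff_unit)

lemma partial_Var: "partial i (Var j) = (if i = j then 1 else 0)"
  by (auto simp: Var_def pdiff_single diff_coeff_unit lookup_unit_index)

inductive_set polys_in :: "'n set \<Rightarrow> ('n, 'k::comm_ring_1) mpoly set" for V where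
  Const: "Const c \<in> polys_in V"
| Var: "i \<in> V \<Longrightarrow> Var i \<in> polys_in V"
| diff: "p \<in> polys_in V \<Longrightarrow> q \<in> polys_in V \<Longrightarrow> p - q \<in> polys_in V"
| mult: "p \<in> polys_in V \<Longrightarrow> q \<in> polys_in V \<Longrightarrow> p * q \<in> polys_in V"

lemma subring_polys_in: "subring (polys_in V)"
  unfolding subring_def
  using polys_in.Const[of 1 V] by (auto intro: polys_in.intros simp: Const_def)

lemma partial_polys_in: "p \<in> polys_in V \<Longrightarrow> i \<notin> V \<Longrightarrow> partial i p = 0"
  by (induction rule: polys_in.induct) (auto simp: pdiff_diff partial_mult partial_Var)

lemma polys_in_mono: "V \<subseteq> W \<Longrightarrow> polys_in V \<subseteq> polys_in W"
proof
  show "p \<in> polys_in W" if "V \<subseteq> W" "p \<in> polys_in V" for p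
    using that(2,1) by (induction rule: polys_in.induct) (auto intro: polys_in.intros)
qed

text \<open>Connects multivariate polynomials with the statements about \<open>adjoin\<close>, which
  treat one generator at a time.\<close>

lemma polys_in_insert:
  "(polys_in (insert v V) :: ('n, 'k::comm_ring_1) mpoly set) = adjoin (polys_in V) (Var v)"
proof (intro antisym subsetI)
  note sub = subring_adjoin[OF subring_polys_in[of V], of "Var v :: ('n, 'k) mpoly"]
  fix p :: "('n, 'k) mpoly" assume "p \<in> polys_in (insert v V)"
  then show "p \<in> adjoin (polys_in V) (Var v)"
  proof (induction rule: polys_in.induct)
    case (Var i)
    show ?case
    proof (cases "i = v")
      case True
      then show ?thesis using adjoin_self[OF subring_polys_in] by simp
    next
      case False
      then show ?thesis using Var by (intro adjoin_base subring_polys_in polys_in.Var) simp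
    qed
  next
    case (Const c)
    then show ?case by (intro adjoin_base subring_polys_in polys_in.Const)
  next
    case (diff p q)
    then show ?case by (intro subring_diff[OF sub])
  next
    case (mult p q)
    then show ?case by (intro subring_mult[OF sub])
  qed
next
  fix p :: "('n, 'k) mpoly" assume "p \<in> adjoin (polys_in V) (Var v)"
  then obtain q where q: "q \<in> polys_over (polys_in V)" "p = poly q (Var v)" by (auto simp: adjoin_def)
  have "coeff q i \<in> polys_in (insert v V)" for i
    using q(1) polys_in_mono[of V "insert v V"] by (auto simp: polys_over_def)
  then show "p \<in> polys_in (insert v V)"
    unfolding q(2) poly_altdef
    by (intro subring_sum[OF subring_polys_in] polys_in.mult subring_power[OF subring_polys_in]
        polys_in.Var) auto
qed

lemma single_in_polys_in: "Poly_Mapping.single \<alpha> c \<in> polys_in (UNIV :: 'n::finite set)"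
proof (induction "index_deg \<alpha>" arbitrary: \<alpha>)
  case 0
  then show ?case using polys_in.Const[of c] index_deg_eq_0 by (metis Const_def)
next
  case (Suc m)
  then obtain \<beta> i where \<beta>: "\<alpha> = \<beta> + unit_index i" "index_deg \<beta> = m" using index_deg_Suc by metis
  have "Poly_Mapping.single \<beta> c * Var i \<in> polys_in UNIV"
    using Suc \<beta> by (intro polys_in.mult polys_in.Var) auto
  then show ?case using \<beta> by (simp add: Var_def mult_single)
qed

lemma polys_in_UNIV: "polys_in (UNIV :: 'n::finite set) = UNIV"
proof -
  have "p \<in> polys_in (UNIV :: 'n set)" for p
  proof (induction p rule: single_add_induct)
    case (single \<alpha> c)
    then show ?case by (rule single_in_polys_in)
  next
    case (add p q)
    then show ?case by (rule subring_add[OF subring_polys_in])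
  qed
  then show ?thesis by blast
qed

section \<open>Local parameters\<close>

definition span_ideal :: "'i set \<Rightarrow> ('i \<Rightarrow> 'a::comm_ring_1) \<Rightarrow> 'a set" where
  "span_ideal S t = {f. \<exists>h. f = (\<Sum>j\<in>S. h j * t j)}"

lemma is_ideal_span_ideal: "is_ideal (span_ideal S t)"
  unfolding is_ideal_def
proof (intro conjI ballI allI)
  show "0 \<in> span_ideal S t" by (auto simp: span_ideal_def intro!: exI[of _ "\<lambda>_. 0"])
next
  fix f g assume "f \<in> span_ideal S t" "g \<in> span_ideal S t"
  then obtain h k where "f = (\<Sum>j\<in>S. h j * t j)" "g = (\<Sum>j\<in>S. k j * t j)"
    by (auto simp: span_ideal_def)
  then have "f + g = (\<Sum>j\<in>S. (h j + k j) * t j)" by (simp add: sum.distrib distrib_right)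
  then show "f + g \<in> span_ideal S t" unfolding span_ideal_def by (intro CollectI exI)
next
  fix r f assume "f \<in> span_ideal S t"
  then obtain h where "f = (\<Sum>j\<in>S. h j * t j)" by (auto simp: span_ideal_def)
  then have "r * f = (\<Sum>j\<in>S. (r * h j) * t j)" by (simp add: sum_distrib_left mult.assoc)
  then show "r * f \<in> span_ideal S t" unfolding span_ideal_def by (intro CollectI exI)
qed

lemma span_ideal_base: "finite S \<Longrightarrow> j \<in> S \<Longrightarrow> t j \<in> span_ideal S t"
  by (auto simp: span_ideal_def if_distrib[of "\<lambda>x. x * _"] sum.delta
      intro!: exI[of _ "\<lambda>i. if i = j then 1 else 0"] cong: if_cong)

lemma ideal_sum:
  "is_ideal L \<Longrightarrow> (\<And>i. i \<in> F \<Longrightarrow> f i \<in> L) \<Longrightarrow> sum f F \<in> L"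
  by (induction F rule: infinite_finite_induct) (simp_all add: is_ideal_def)

lemma span_ideal_least:
  assumes "is_ideal L" "\<And>j. j \<in> S \<Longrightarrow> t j \<in> L"
  shows "span_ideal S t \<subseteq> L"
proof
  fix f assume "f \<in> span_ideal S t"
  then obtain h where f: "f = (\<Sum>j\<in>S. h j * t j)" by (auto simp: span_ideal_def)
  show "f \<in> L" unfolding f
  proof (rule ideal_sum[OF assms(1)])
    fix j assume "j \<in> S"
    then show "h j * t j \<in> L" using assms by (simp add: is_ideal_def)
  qed
qed

context max_ideal
begin

text \<open>For an ideal \<open>L\<close> this is the contraction to the global ring of its
  extension to the local ring at \<open>P\<close>; stated with denominators cleared, it avoids
  constructing that ring.\<close>

definition localize :: "'a set \<Rightarrow> 'a set" where
  "localize L = {f. \<exists>s. s \<notin> P \<and> s * f \<in> L}"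

lemma localizeI: "s \<notin> P \<Longrightarrow> s * f \<in> L \<Longrightarrow> f \<in> localize L"
  by (auto simp: localize_def)

lemma localize_base: "f \<in> L \<Longrightarrow> f \<in> localize L"
  using one_notin_P by (intro localizeI[of 1]) simp_all

lemma localize_mono: "L \<subseteq> M \<Longrightarrow> localize L \<subseteq> localize M"
  by (auto simp: localize_def)

lemma is_ideal_localize:
  assumes L: "is_ideal L" shows "is_ideal (localize L)"
  unfolding is_ideal_def
proof (intro conjI ballI allI)
  show "0 \<in> localize L" using L by (intro localize_base) (simp add: is_ideal_def)
next
  fix f g assume "f \<in> localize L" "g \<in> localize L"
  then obtain s r where sr: "s \<notin> P" "r \<notin> P" "s * f \<in> L" "r * g \<in> L" by (auto simp: localize_def)
  then have "r * (s * f) + s * (r * g) \<in> L" using L by (simp add: is_ideal_def)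
  then have "(s * r) * (f + g) \<in> L" by (simp add: algebra_simps)
  then show "f + g \<in> localize L" using sr by (intro localizeI[of "s * r"]) (simp_all add: prime_P)
next
  fix r f assume "f \<in> localize L"
  then obtain s where s: "s \<notin> P" "s * f \<in> L" by (auto simp: localize_def)
  then have "r * (s * f) \<in> L" using L by (simp add: is_ideal_def)
  then have "s * (r * f) \<in> L" by (simp add: mult.left_commute)
  then show "r * f \<in> localize L" using s by (intro localizeI)
qed

lemma localize_cancel: assumes "s \<notin> P" "s * f \<in> localize L" shows "f \<in> localize L"
proof -
  obtain r where "r \<notin> P" "r * (s * f) \<in> L" using assms by (auto simp: localize_def)
  then show ?thesis using assms by (intro localizeI[of "r * s"]) (simp_all add: prime_P mult.assoc)
qed

end

lemma subring_of_nat: "subring A \<Longrightarrow> of_nat n \<in> A"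
  by (induction n) (simp_all add: subring_0 subring_1 subring_add)

text \<open>The coefficients of \<open>q\<close> do not involve \<open>v\<close>, so the partial
  derivative acts as the formal derivative in one variable. Its coefficients are recorded because
  minimality of \<open>q\<close> is applied to them.\<close>

lemma partial_poly:
  assumes "v \<notin> V" "q \<in> polys_over (polys_in V)"
  obtains q' where "q' \<in> polys_over (polys_in V)"
    "partial v (poly q (Var v)) = poly q' (Var v)"
    "\<And>n. coeff q' n = of_nat (Suc n) * coeff q (Suc n)"
proof -
  have "\<exists>q'. partial v (poly q (Var v)) = poly q' (Var v) \<and>
      (\<forall>n. coeff q' n = of_nat (Suc n) * coeff q (Suc n))"
    using assms(2)
  proof (induction q)
    case 0
    then show ?case by (intro exI[of _ 0]) simp
  next
    case (pCons a p)
    have a: "a \<in> polys_in V" and p: "p \<in> polys_over (polys_in V)"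
      using pCons.prems by (auto simp: polys_over_def coeff_pCons split: nat.splits)
    obtain p' where p': "partial v (poly p (Var v)) = poly p' (Var v)"
      "\<And>n. coeff p' n = of_nat (Suc n) * coeff p (Suc n)"
      using pCons.IH[OF p] by blast
    have "partial v (poly (pCons a p) (Var v)) = poly (p + pCons 0 p') (Var v)"
      using partial_polys_in[OF a assms(1)]
      by (simp add: pdiff_add partial_mult partial_Var p'(1))
    moreover have "coeff (p + pCons 0 p') n = of_nat (Suc n) * coeff (pCons a p) (Suc n)" for n
      using p'(2) by (cases n) (simp_all add: distrib_right)
    ultimately show ?case by blast
  qed
  then obtain q' where q': "partial v (poly q (Var v)) = poly q' (Var v)"
    "\<And>n. coeff q' n = of_nat (Suc n) * coeff q (Suc n)" by blast
  moreover have "q' \<in> polys_over (polys_in V)"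
  proof -
    have "of_nat (Suc n) * coeff q (Suc n) \<in> polys_in V" for n
      using assms(2)
      by (intro polys_in.mult subring_of_nat subring_polys_in) (simp add: polys_over_def)
    then show ?thesis by (simp only: polys_over_def q'(2) mem_Collect_eq) simp
  qed
  ultimately show ?thesis using that by blast
qed

locale mpoly_max_ideal = max_ideal P
  for P :: "('n::finite, 'k::field_char_0) mpoly set"
begin

lemma Const_notin_P: assumes "c \<noteq> 0" shows "Const c \<notin> P"
proof
  assume "Const c \<in> P"
  then have "Const (inverse c) * Const c \<in> P" by (rule P_mult)
  then show False using assms one_notin_P by (simp add: Const_def mult_single)
qed

text \<open>Characteristic 0 acts through this fact, on the derivative of a minimal polynomial and
  on the integer factors of differentiated monomials.\<close>

lemma of_nat_notin_P: "n > 0 \<Longrightarrow> of_nat n \<notin> P"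
  using Const_notin_P[of "of_nat n"] by (simp add: Const_def)

text \<open>Induction on the complement of \<open>V\<close>: the whole ring is a field modulo
  \<open>P\<close>, and \<open>almost_field_descend\<close> allows the variables to be removed one
  by one.\<close>

lemma almost_field_polys_in: "almost_field (polys_in V)"
proof -
  have "almost_field (polys_in (- W))" if "finite W" for W
    using that
  proof (induction W)
    case empty
    have "\<exists>c. \<exists>k::nat. b * c - 1 ^ k \<in> P" if "b \<notin> P" for b
      using inverse_mod[OF that] by (metis power_one)
    then show ?case
      using one_notin_P unfolding almost_field_def
      by (intro bexI[of _ 1]) (simp_all add: polys_in_UNIV)
  next
    case (insert w W)
    have "- W = insert w (- insert w W)" using insert.hyps by auto
    then show ?case
      using insert.IH almost_field_descend[OF subring_polys_in, of "- insert w W" "Var w"]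
      by (simp add: polys_in_insert)
  qed
  from this[of "- V"] show ?thesis by simp
qed

lemma Var_algebraic:
  "\<exists>q\<in>polys_over (polys_in V). q \<notin> polys_over P \<and> poly q (Var v) \<in> P"
  using algebraic_of_almost_field[OF subring_polys_in, of V "Var v"]
    almost_field_polys_in[of "insert v V"] by (simp add: polys_in_insert)

text \<open>The derivatives are prescribed for all \<open>i\<close>, also outside \<open>V\<close>:
  when a variable is added, the old parameters must already have derivative 0 modulo
  \<open>P\<close> in its direction. For \<open>V = UNIV\<close> the last condition says that
  \<open>t\<close> generates the maximal ideal of the local ring.\<close>

definition local_parameters :: "'n set \<Rightarrow> ('n \<Rightarrow> ('n, 'k) mpoly) \<Rightarrow> bool" where
  "local_parameters V t \<longleftrightarrow> (\<forall>j\<in>V. t j \<in> P) \<and>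
    (\<forall>j\<in>V. \<forall>i. partial i (t j) - of_bool (i = j) \<in> P) \<and>
    polys_in V \<inter> P \<subseteq> localize (span_ideal V t)"

text \<open>
  The new parameter is the value \<open>F\<close> of a minimal polynomial of \<open>Var v\<close> over \<open>polys_in V\<close>, with its other
  partial derivatives cleared by means of the old parameters and normalised by an inverse of
  \<open>\<partial>\<^sub>v F\<close>. That derivative is not in \<open>P\<close> by minimality, as the characteristic is \<open>0\<close>.
\<close>

lemma local_parameters_insert:
  assumes v: "v \<notin> V" and t: "local_parameters V t"
  shows "\<exists>t'. local_parameters (insert v V) t'"
proof -
  let ?x = "Var v" and ?A = "polys_in V :: ('n, 'k) mpoly set"
  have A: "subring ?A" by (rule subring_polys_in)
  have tP: "t j \<in> P" and tD: "partial i (t j) - of_bool (i = j) \<in> P" if "j \<in> V" for i j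
    using t that by (auto simp: local_parameters_def)
  obtain q where q: "q \<in> polys_over ?A" "poly q ?x \<in> P" "lead_coeff q \<notin> P" "degree q > 0"
    and q_min: "\<And>f. f \<in> polys_over ?A \<Longrightarrow> poly f ?x \<in> P \<Longrightarrow> \<forall>i\<ge>degree q. coeff f i = 0 \<Longrightarrow> f \<in> polys_over P"
    and q_gen: "\<And>f. f \<in> polys_over ?A \<Longrightarrow> poly f ?x \<in> P \<Longrightarrow>
       \<exists>c\<in>?A - P. \<exists>h\<in>polys_over ?A. smult c f - q * h \<in> polys_over P"
    using minimal_polynomial[OF A Var_algebraic[of V v]] by metis
  define F where "F = poly q ?x"
  have F: "F \<in> P" "F \<in> polys_in (insert v V)"
    using q by (auto simp: F_def polys_in_insert adjoin_def)
  define u where "u = partial v F"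
  have u: "u \<notin> P"
  proof
    assume "u \<in> P"
    obtain q' where q': "q' \<in> polys_over ?A" "u = poly q' ?x"
      "\<And>n. coeff q' n = of_nat (Suc n) * coeff q (Suc n)"
      using partial_poly[OF v q(1)] by (metis u_def F_def)
    have "q' \<in> polys_over P"
      using q' \<open>u \<in> P\<close> by (intro q_min) (simp_all add: coeff_eq_0)
    then have "coeff q' (degree q - 1) \<in> P" by (simp add: polys_over_def)
    then have "of_nat (degree q) * lead_coeff q \<in> P"
      using q(4) unfolding q'(3) by (simp del: of_nat_Suc)
    then show False using q(3) of_nat_notin_P[OF q(4)] by (simp add: prime_P)
  qed
  then obtain w where w: "u * w - 1 \<in> P" by (rule inverse_mod)
  have wP: "w \<notin> P" using w one_notin_P P_cong P_mult by blast
  define G where "G = F - (\<Sum>i\<in>V. partial i F * t i)"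
  have GP: "G \<in> P" unfolding G_def by (intro P_diff F P_sum P_mult tP)
  define t' where "t' = t(v := w * G)"
  have t'_V: "t' j = t j" if "j \<in> V" for j using that v by (auto simp: t'_def)
  have t'_v: "t' v = w * G" by (simp add: t'_def)
  have D: "partial k (w * G) - of_bool (k = v) \<in> P" for k
  proof -
    let ?S = "\<Sum>i\<in>V. partial i F * of_bool (k = i)"
    have "partial k G - (partial k F - ?S) =
        - (\<Sum>i\<in>V. partial k (partial i F) * t i + partial i F * (partial k (t i) - of_bool (k = i)))"
      by (simp add: G_def pdiff_diff pdiff_sum partial_mult sum.distrib right_diff_distrib sum_subtractf)
    also have "\<dots> \<in> P" by (intro P_minus P_sum P_add P_mult tP tD)
    finally have 1: "partial k G - (partial k F - ?S) \<in> P" .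
    have S: "?S = (if k \<in> V then partial k F else 0)"
      by (simp add: of_bool_def if_distrib[of "\<lambda>x. _ * x"] sum.delta' cong: if_cong)
    \<comment> \<open>In the directions of \<open>V\<close> the correction cancels the derivative of
      \<open>F\<close>, in direction \<open>v\<close> it is absent, and \<open>F\<close> does not
      involve any other variable.\<close>
    have 2: "partial k F - ?S = (if k = v then u else 0)"
    proof (cases "k \<in> insert v V")
      case True
      then show ?thesis using v by (auto simp: S u_def)
    next
      case False
      then show ?thesis using partial_polys_in[OF F(2) False] by (simp add: S)
    qed
    have "partial k (w * G) - of_bool (k = v) = partial k w * G
        + w * (partial k G - (partial k F - ?S)) + (if k = v then u * w - 1 else 0)"
      unfolding 2 by (simp add: partial_mult algebra_simps)
    also have "\<dots> \<in> P" using w by (intro P_add P_mult GP 1) (simp add: P_0)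
    finally show ?thesis .
  qed
  let ?L = "localize (span_ideal (insert v V) t')"
  have L: "is_ideal ?L" by (intro is_ideal_localize is_ideal_span_ideal)
  have Ladd: "a + b \<in> ?L" if "a \<in> ?L" "b \<in> ?L" for a b
    using L that by (simp add: is_ideal_def)
  have Lmult: "r * a \<in> ?L" if "a \<in> ?L" for a r
    using L that by (simp add: is_ideal_def)
  have t'L: "t' j \<in> ?L" if "j \<in> insert v V" for j
    using that by (intro localize_base span_ideal_base) simp_all
  have VL: "polys_in V \<inter> P \<subseteq> ?L"
  proof -
    have "span_ideal V t \<subseteq> span_ideal (insert v V) t'"
    proof (rule span_ideal_least[OF is_ideal_span_ideal])
      fix j assume "j \<in> V"
      then show "t j \<in> span_ideal (insert v V) t'"
        using span_ideal_base[of "insert v V" j t'] t'_V by simp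
    qed
    then have "localize (span_ideal V t) \<subseteq> ?L" by (rule localize_mono)
    moreover have "polys_in V \<inter> P \<subseteq> localize (span_ideal V t)"
      using t by (simp add: local_parameters_def)
    ultimately show ?thesis by (rule order_trans[rotated])
  qed
  have FL: "F \<in> ?L"
  proof (rule localize_cancel[OF wP])
    have "w * F = w * G + w * (\<Sum>i\<in>V. partial i F * t i)"
      by (simp add: G_def right_diff_distrib)
    also have "\<dots> = t' v + w * (\<Sum>i\<in>V. partial i F * t' i)"
      using t'_V by (simp add: t'_v)
    also have "\<dots> \<in> ?L"
      by (intro Ladd Lmult ideal_sum[OF L] t'L) simp_all
    finally show "w * F \<in> ?L" .
  qed
  have "f \<in> ?L" if f: "f \<in> polys_in (insert v V)" "f \<in> P" for f
  proof -
    obtain \<phi> where \<phi>: "\<phi> \<in> polys_over ?A" "f = poly \<phi> ?x"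
      using f by (auto simp: polys_in_insert adjoin_def)
    \<comment> \<open>Dividing by the minimal polynomial gives
      \<open>c * f = poly h ?x * F + poly r ?x\<close>. The coefficients of \<open>r\<close> lie in
      \<open>polys_in V\<close> and in \<open>P\<close>, so the old parameters already account for
      them.\<close>
    obtain c h where ch: "c \<in> ?A" "c \<notin> P" "h \<in> polys_over ?A" "smult c \<phi> - q * h \<in> polys_over P"
      using q_gen[OF \<phi>(1)] \<phi>(2) f(2) by blast
    define r where "r = smult c \<phi> - q * h"
    have "r \<in> polys_over ?A" unfolding r_def
      by (intro subring_diff subring_mult subring_polys_over A smult_polys_over ch q \<phi>)
    then have "coeff r i \<in> ?L" for i
      using ch(4) VL by (auto simp: r_def[symmetric] polys_over_def)
    then have "?x ^ i * coeff r i \<in> ?L" for i using Lmult by blast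
    then have "poly r ?x \<in> ?L"
      unfolding poly_altdef by (intro ideal_sum[OF L]) (simp add: mult.commute)
    moreover have "poly h ?x * F \<in> ?L" using FL Lmult by blast
    ultimately have "poly h ?x * F + poly r ?x \<in> ?L" using Ladd by blast
    moreover have "c * f = poly h ?x * F + poly r ?x"
      by (simp add: r_def \<phi>(2) F_def algebra_simps)
    ultimately show ?thesis using localize_cancel[OF ch(2)] by metis
  qed
  then have 3: "polys_in (insert v V) \<inter> P \<subseteq> ?L" by blast
  have 1: "t' j \<in> P" if "j \<in> insert v V" for j
  proof (cases "j = v")
    case True
    then show ?thesis using P_mult[OF GP] t'_v by simp
  next
    case False
    then show ?thesis using that tP t'_V by simp
  qed
  have 2: "partial i (t' j) - of_bool (i = j) \<in> P" if "j \<in> insert v V" for i j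
  proof (cases "j = v")
    case True
    then show ?thesis using D[of i] t'_v by simp
  next
    case False
    then show ?thesis using that tD[of j i] t'_V by simp
  qed
  show ?thesis unfolding local_parameters_def using 1 2 3 by blast
qed

lemma ex_local_parameters: "\<exists>t. local_parameters UNIV t"
proof -
  have "\<exists>t. local_parameters V t" if "finite V" for V
    using that
  proof (induction V)
    case empty
    have "\<exists>c. f = Const c" if "f \<in> polys_in {}" for f :: "('n, 'k) mpoly"
      using that
    proof induction
      case (diff p q)
      then show ?case by (metis Const_def single_diff)
    next
      case (mult p q)
      then show ?case by (metis Const_def mult_single add_0)
    qed auto
    then have z: "polys_in {} \<inter> P \<subseteq> {0}"
      using Const_notin_P by (metis Const_def Int_iff insertI1 single_zero subsetI)
    have "0 \<in> localize (span_ideal {} t)" for t :: "'n \<Rightarrow> ('n, 'k) mpoly"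
      using is_ideal_localize[OF is_ideal_span_ideal[of "{}" t]] by (simp add: is_ideal_def)
    then show ?case using z by (auto simp: local_parameters_def)
  next
    case (insert v V)
    then show ?case using local_parameters_insert by blast
  qed
  then show ?thesis by simp
qed

end

section \<open>Separation of vectors modulo a maximal ideal\<close>

context max_ideal
begin

text \<open>The double annihilator theorem for subspaces of a coordinate space over \<kappa>(P),
  with vectors given by representatives. The hypothesis on vectors with entries in \<open>P\<close>
  makes congruent representatives interchangeable and entries outside \<open>B\<close> irrelevant.
  As \<open>S\<close> comes without a basis, the induction runs over the coordinates.\<close>

lemma separating_vector:
  assumes "finite B"
    and "\<And>s t. s \<in> S \<Longrightarrow> t \<in> S \<Longrightarrow> (\<lambda>i. s i - t i) \<in> S"
    and "\<And>r s. s \<in> S \<Longrightarrow> (\<lambda>i. r * s i) \<in> S"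
    and "\<And>s. \<forall>i\<in>B. s i \<in> P \<Longrightarrow> s \<in> S"
    and "d \<notin> S"
  shows "\<exists>v. (\<forall>s\<in>S. (\<Sum>i\<in>B. s i * v i) \<in> P) \<and> (\<Sum>i\<in>B. d i * v i) \<notin> P"
  using assms
proof (induction B arbitrary: S d)
  case empty
  then show ?case by simp
next
  case (insert a B)
  note S_diff = insert.prems(1) and S_scale = insert.prems(2) and S_P = insert.prems(3)
  \<comment> \<open>Gaussian elimination: \<open>red\<close> below clears the coordinate \<open>a\<close> with a pivot \<open>e\<close>.\<close>
  have a: "a \<notin> B" and B: "finite B" by fact+
  \<comment> \<open>If all of \<open>S\<close> vanishes at \<open>a\<close> modulo \<open>P\<close>
    but \<open>d\<close> does not, the coordinate form at \<open>a\<close> separates. Otherwise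
    coordinate \<open>a\<close> can be cleared from \<open>S\<close> and \<open>d\<close>
    alike.\<close>
  show ?case
  proof (cases "(\<exists>s\<in>S. s a \<notin> P) \<or> d a \<in> P")
    case True
    \<comment> \<open>A pivot is scaled to have entry 1 at \<open>a\<close> modulo \<open>P\<close>.
      Without a pivot all these entries are in \<open>P\<close> already, and the zero vector serves,
      for which \<open>red\<close> changes nothing.\<close>
    have "\<exists>e\<in>S. \<forall>s\<in>insert d S. s a - s a * e a \<in> P"
    proof (cases "\<exists>s\<in>S. s a \<notin> P")
      case True
      then obtain s0 where s0: "s0 \<in> S" "s0 a \<notin> P" by blast
      then obtain w where w: "s0 a * w - 1 \<in> P" using inverse_mod by blast
      have "s a - s a * (w * s0 a) \<in> P" for s
      proof -
        have "s a - s a * (w * s0 a) = - (s a * (s0 a * w - 1))" by (simp add: algebra_simps)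
        then show ?thesis using P_minus[OF P_mult[OF w]] by simp
      qed
      then show ?thesis using S_scale[OF s0(1), of w] by (intro bexI[of _ "\<lambda>i. w * s0 i"]) simp_all
    next
      case False
      have "(\<lambda>_. 0) \<in> S" by (rule S_P) (simp add: P_0)
      then show ?thesis using False True by (intro bexI[of _ "\<lambda>_. 0"]) auto
    qed
    then obtain e where e: "e \<in> S" and ea: "\<And>s. s \<in> insert d S \<Longrightarrow> s a - s a * e a \<in> P" by blast
    define S' where "S' = {s. (\<lambda>i. if i = a then 0 else s i) \<in> S}"
    define red where "red s i = s i - s a * e i" for s i
    have red_a: "red s a \<in> P" if "s \<in> insert d S" for s
      using ea[OF that] by (simp add: red_def)
    have red_S': "red s \<in> S'" if "s \<in> S" for s
    proof -
      have r: "red s \<in> S"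
        unfolding red_def by (intro S_diff[OF that] S_scale[OF e])
      have "(\<lambda>i. if i = a then red s a else 0) \<in> S"
        by (rule S_P) (use red_a[of s] that in \<open>simp add: P_0\<close>)
      from S_diff[OF r this] have "(\<lambda>i. red s i - (if i = a then red s a else 0)) \<in> S" .
      moreover have "(\<lambda>i. red s i - (if i = a then red s a else 0)) = (\<lambda>i. if i = a then 0 else red s i)"
        by auto
      ultimately show ?thesis by (simp add: S'_def)
    qed
    have d: "red d \<notin> S'"
    proof
      assume "red d \<in> S'"
      then have 1: "(\<lambda>i. if i = a then 0 else red d i) \<in> S" by (simp add: S'_def)
      have "(\<lambda>i. if i = a then - red d a else 0) \<in> S"
        by (rule S_P) (use P_minus[OF red_a[of d]] in \<open>simp add: P_0\<close>)
      from S_diff[OF 1 this] have "(\<lambda>i. (if i = a then 0 else red d i) - (if i = a then - red d a else 0)) \<in> S" .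
      moreover have "(\<lambda>i. (if i = a then 0 else red d i) - (if i = a then - red d a else 0)) = red d"
        by auto
      ultimately have 2: "red d \<in> S" by simp
      from S_diff[OF this S_scale[OF e]] have "(\<lambda>i. red d i - (- d a) * e i) \<in> S" .
      moreover have "(\<lambda>i. red d i - (- d a) * e i) = d" by (simp add: red_def)
      ultimately show False using insert.prems(4) by simp
    qed
    have "\<exists>v. (\<forall>s\<in>S'. (\<Sum>i\<in>B. s i * v i) \<in> P) \<and> (\<Sum>i\<in>B. red d i * v i) \<notin> P"
    proof (rule insert.IH[OF _ _ _ d])
      fix s t assume "s \<in> S'" "t \<in> S'"
      then have "(\<lambda>i. (if i = a then 0 else s i) - (if i = a then 0 else t i)) \<in> S"
        unfolding S'_def by (intro S_diff) simp_all
      moreover have "(\<lambda>i. (if i = a then 0 else s i) - (if i = a then 0 else t i))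
          = (\<lambda>i. if i = a then 0 else s i - t i)" by auto
      ultimately show "(\<lambda>i. s i - t i) \<in> S'" by (simp add: S'_def)
    next
      fix r s assume "s \<in> S'"
      then have "(\<lambda>i. r * (if i = a then 0 else s i)) \<in> S" unfolding S'_def by (intro S_scale) simp
      moreover have "(\<lambda>i. r * (if i = a then 0 else s i)) = (\<lambda>i. if i = a then 0 else r * s i)" by auto
      ultimately show "(\<lambda>i. r * s i) \<in> S'" by (simp add: S'_def)
    next
      fix s assume "\<forall>i\<in>B. s i \<in> P"
      then have "(\<lambda>i. if i = a then 0 else s i) \<in> S" by (intro S_P) (simp add: P_0)
      then show "s \<in> S'" by (simp add: S'_def)
    qed
    then obtain v where v: "\<And>s. s \<in> S' \<Longrightarrow> (\<Sum>i\<in>B. s i * v i) \<in> P" "(\<Sum>i\<in>B. red d i * v i) \<notin> P"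
      by blast
    \<comment> \<open>The entry at \<open>a\<close> is the transpose of the elimination:
      \<open>v'\<close> takes on \<open>s\<close> the value that \<open>v\<close> takes on
      \<open>red s\<close>.\<close>
    define v' where "v' = v(a := - (\<Sum>i\<in>B. e i * v i))"
    have eq: "(\<Sum>i\<in>insert a B. s i * v' i) = (\<Sum>i\<in>B. red s i * v i)" for s
    proof -
      have "(\<Sum>i\<in>B. s i * v' i) = (\<Sum>i\<in>B. s i * v i)"
        using a by (intro sum.cong) (auto simp: v'_def)
      then show ?thesis
        using a B by (simp add: v'_def red_def left_diff_distrib sum_subtractf sum_distrib_left mult.assoc)
    qed
    show ?thesis
      by (intro exI[of _ v'] conjI ballI) (simp_all only: eq v red_S' not_False_eq_True)
  next
    case False
      define v where "v i = (if i = a then 1 else 0 :: 'a)" for i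
      have "(\<Sum>i\<in>insert a B. s i * v i) = s a" for s
        using a B by (simp add: v_def if_distrib[of "\<lambda>x. _ * x"] sum.delta' cong: if_cong)
      then show ?thesis using False by (intro exI[of _ v]) auto
  qed
qed

end

section \<open>Differential powers and Taylor expansion\<close>

context mpoly_max_ideal
begin

text \<open>The ideal \<open>J_m\<close> of the overview, a differential power of \<open>P\<close>.
  The strict bound makes \<open>dpow 1\<close> equal to \<open>P\<close>.\<close>

definition dpow :: "nat \<Rightarrow> ('n, 'k) mpoly set" where
  "dpow m = {f. \<forall>\<beta>. index_deg \<beta> < m \<longrightarrow> pdiff \<beta> f \<in> P}"

lemma dpowD: "f \<in> dpow m \<Longrightarrow> index_deg \<beta> < m \<Longrightarrow> pdiff \<beta> f \<in> P"
  by (simp add: dpow_def)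

lemma dpow_0: "f \<in> dpow 0"
  by (simp add: dpow_def)

lemma dpow_antimono: "f \<in> dpow n \<Longrightarrow> m \<le> n \<Longrightarrow> f \<in> dpow m"
  by (simp add: dpow_def)

lemma dpow_add: "f \<in> dpow m \<Longrightarrow> g \<in> dpow m \<Longrightarrow> f + g \<in> dpow m"
  by (simp add: dpow_def pdiff_add P_add)

lemma dpow_sum: "(\<And>i. i \<in> F \<Longrightarrow> f i \<in> dpow m) \<Longrightarrow> sum f F \<in> dpow m"
  by (simp add: dpow_def pdiff_sum P_sum)

lemma dpow_Suc: "f \<in> dpow (Suc m) \<longleftrightarrow> f \<in> P \<and> (\<forall>i. partial i f \<in> dpow m)"
proof (intro iffI conjI allI)
  assume f: "f \<in> dpow (Suc m)"
  show "f \<in> P" using dpowD[OF f, of 0] by simp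
  show "partial i f \<in> dpow m" for i
    unfolding dpow_def
  proof (intro CollectI allI impI)
    fix \<beta> :: "'n \<Rightarrow>\<^sub>0 nat" assume "index_deg \<beta> < m"
    then show "pdiff \<beta> (partial i f) \<in> P"
      using dpowD[OF f, of "\<beta> + unit_index i"] by (simp add: index_deg_add pdiff_add_unit)
  qed
next
  assume f: "f \<in> P \<and> (\<forall>i. partial i f \<in> dpow m)"
  show "f \<in> dpow (Suc m)"
    unfolding dpow_def
  proof (intro CollectI allI impI)
    fix \<beta> :: "'n \<Rightarrow>\<^sub>0 nat" assume \<beta>: "index_deg \<beta> < Suc m"
    show "pdiff \<beta> f \<in> P"
    proof (cases "index_deg \<beta>")
      case 0
      then show ?thesis using f index_deg_eq_0[OF 0] by simp
    next
      case (Suc k)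
      then obtain \<gamma> i where \<gamma>: "\<beta> = \<gamma> + unit_index i" "index_deg \<gamma> = k" by (rule index_deg_Suc)
      then show ?thesis using f \<beta> Suc dpowD[of "partial i f" m \<gamma>] by (simp add: pdiff_add_unit)
    qed
  qed
qed

lemma dpow_mult: "f \<in> dpow m \<Longrightarrow> h * f \<in> dpow m"
proof (induction m arbitrary: f h)
  case 0
  then show ?case by (simp add: dpow_0)
next
  case (Suc m)
  have "f \<in> dpow m" using dpow_antimono[OF Suc.prems] by simp
  then show ?case
    using Suc.prems unfolding dpow_Suc
    by (simp add: P_mult partial_mult dpow_add Suc.IH)
qed

text \<open>By the product rule, a derivative falling on \<open>p\<close> leaves the order of
  \<open>g\<close> intact; one falling on \<open>g\<close> lowers it by one, and the factor
  \<open>p\<close> restores it by induction.\<close>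

lemma dpow_mult_P:
  assumes "g \<in> dpow m" "p \<in> P" shows "p * g \<in> dpow (Suc m)"
  using assms(1)
proof (induction m arbitrary: g)
  case 0
  then show ?case using assms(2) by (simp add: dpow_Suc dpow_0 P_mult2)
next
  case (Suc m)
  have "p * partial i g \<in> dpow (Suc m)" for i
    using Suc.prems by (intro Suc.IH) (simp add: dpow_Suc)
  then have "partial i (p * g) \<in> dpow (Suc m)" for i
    unfolding partial_mult using dpow_add[OF dpow_mult[OF Suc.prems]] by blast
  then show ?case using assms(2) dpow_Suc[of "p * g" "Suc m"] P_mult2 by blast
qed

text \<open>In the Leibniz formula every term that differentiates \<open>h\<close> contains a
  derivative of \<open>g\<close> of order below \<open>m\<close>, which is in
  \<open>P\<close>.\<close>

lemma pdiff_mult_dpow: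
  "g \<in> dpow m \<Longrightarrow> index_deg \<gamma> = m \<Longrightarrow> pdiff \<gamma> (h * g) - h * pdiff \<gamma> g \<in> P"
proof (induction m arbitrary: \<gamma> g h)
  case 0
  then show ?case using index_deg_eq_0[OF 0(2)] by (simp add: P_0)
next
  case (Suc m)
  obtain \<gamma>' i where \<gamma>: "\<gamma> = \<gamma>' + unit_index i" "index_deg \<gamma>' = m"
    using index_deg_Suc[OF Suc.prems(2)] .
  have "pdiff \<gamma>' (partial i h * g) \<in> P"
    by (rule dpowD[OF dpow_mult[OF Suc.prems(1)]]) (simp add: \<gamma>)
  moreover have "pdiff \<gamma>' (h * partial i g) - h * pdiff \<gamma>' (partial i g) \<in> P"
    using Suc.prems(1) \<gamma>(2) by (intro Suc.IH) (simp_all add: dpow_Suc)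
  ultimately have "pdiff \<gamma>' (partial i h * g) + (pdiff \<gamma>' (h * partial i g) - h * pdiff \<gamma>' (partial i g)) \<in> P"
    by (rule P_add)
  then show ?case by (simp add: \<gamma>(1) pdiff_add_unit partial_mult pdiff_add add_diff_eq)
qed

text \<open>The hypothesis says that the derivatives of \<open>\<rho>\<close> of orders 1 to
  \<open>k\<close> lie in \<open>P\<close>, so up to order \<open>k\<close> it behaves like a
  constant. Such \<open>\<rho>\<close> replace the missing embedding of \<kappa>(P) into the
  ring.\<close>

lemma pdiff_mult_constant:
  "index_deg \<alpha> = k \<Longrightarrow> (\<And>i. partial i \<rho> \<in> dpow k) \<Longrightarrow> pdiff \<alpha> (\<rho> * g) - \<rho> * pdiff \<alpha> g \<in> P"
proof (induction k arbitrary: \<alpha> g)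
  case 0
  then show ?case using index_deg_eq_0[OF 0(1)] by (simp add: P_0)
next
  case (Suc k)
  obtain \<alpha>' i where \<alpha>: "\<alpha> = \<alpha>' + unit_index i" "index_deg \<alpha>' = k"
    using index_deg_Suc[OF Suc.prems(1)] .
  have "pdiff \<alpha>' (g * partial i \<rho>) \<in> P"
    by (rule dpowD[OF dpow_mult[OF Suc.prems(2)]]) (simp add: \<alpha>)
  moreover have "pdiff \<alpha>' (\<rho> * partial i g) - \<rho> * pdiff \<alpha>' (partial i g) \<in> P"
    by (rule Suc.IH[OF \<alpha>(2)]) (rule dpow_antimono[OF Suc.prems(2)], simp)
  ultimately have "pdiff \<alpha>' (g * partial i \<rho>) + (pdiff \<alpha>' (\<rho> * partial i g) - \<rho> * pdiff \<alpha>' (partial i g)) \<in> P"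
    by (rule P_add)
  then show ?case
    by (simp add: \<alpha>(1) pdiff_add_unit partial_mult pdiff_add add_diff_eq mult.commute[of g])
qed

end

locale mpoly_local_parameters = mpoly_max_ideal P
  for P :: "('n::finite, 'k::field_char_0) mpoly set" +
  fixes t :: "'n \<Rightarrow> ('n, 'k) mpoly"
  assumes t: "local_parameters UNIV t"
begin

lemma t_P: "t j \<in> P" and partial_t: "partial i (t j) - of_bool (i = j) \<in> P"
  using t by (auto simp: local_parameters_def)

lemma P_localize_t: "f \<in> P \<Longrightarrow> f \<in> localize (span_ideal UNIV t)"
  using t by (auto simp: local_parameters_def polys_in_UNIV)

text \<open>Modulo \<open>P\<close> and in leading order, \<open>t j\<close> acts like the variable
  \<open>j\<close>: one of the derivatives in direction \<open>j\<close> is spent on it, and the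
  factor counts the choices. All other Leibniz terms have too few derivatives left on
  \<open>g\<close>, or carry a factor in \<open>P\<close>.\<close>

lemma pdiff_t_mult:
  "g \<in> dpow m \<Longrightarrow> index_deg \<beta> = Suc m \<Longrightarrow>
    pdiff \<beta> (t j * g) - of_nat (Poly_Mapping.lookup \<beta> j) * pdiff (\<beta> - unit_index j) g \<in> P"
proof (induction m arbitrary: \<beta> g)
  case (0 \<beta>)
  obtain \<gamma> i where \<gamma>: "\<beta> = \<gamma> + unit_index i" "index_deg \<gamma> = 0" using index_deg_Suc[OF 0(2)] .
  have \<beta>: "\<beta> = unit_index i" using \<gamma> index_deg_eq_0[OF \<gamma>(2)] by simp
  have "(partial i (t j) - of_bool (i = j)) * g + t j * partial i g \<in> P"
    by (intro P_add P_mult2 partial_t t_P)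
  then show ?case
    by (cases "i = j") (simp_all add: \<beta> partial_mult lookup_unit_index left_diff_distrib add_diff_eq algebra_simps)
next
  case (Suc m \<beta>)
  obtain \<gamma> i where \<gamma>: "\<beta> = \<gamma> + unit_index i" "index_deg \<gamma> = Suc m"
    using index_deg_Suc[OF Suc.prems(2)] .
  let ?c = "Poly_Mapping.lookup \<gamma> j"
  have 1: "pdiff \<gamma> (partial i (t j) * g) - partial i (t j) * pdiff \<gamma> g \<in> P"
    by (rule pdiff_mult_dpow[OF Suc.prems(1) \<gamma>(2)])
  have 2: "(partial i (t j) - of_bool (i = j)) * pdiff \<gamma> g \<in> P"
    by (intro P_mult2 partial_t)
  have 3: "pdiff \<gamma> (t j * partial i g) - of_nat ?c * pdiff (\<gamma> - unit_index j) (partial i g) \<in> P"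
    using Suc.prems(1) by (intro Suc.IH \<gamma>(2)) (simp add: dpow_Suc)
  have 4: "of_nat (Poly_Mapping.lookup \<beta> j) * pdiff (\<beta> - unit_index j) g
      = of_bool (i = j) * pdiff \<gamma> g + of_nat ?c * pdiff (\<gamma> - unit_index j) (partial i g)"
  proof (cases "i = j")
    case True
    have "\<beta> - unit_index j = \<gamma>" by (simp add: \<gamma> True)
    moreover have "of_nat ?c * pdiff (\<gamma> - unit_index j) (partial i g) = of_nat ?c * pdiff \<gamma> g"
    proof (cases "?c = 0")
      case False
      then show ?thesis using index_minus_unit[of \<gamma> j] by (simp add: True flip: pdiff_add_unit)
    qed simp
    ultimately show ?thesis by (simp add: \<gamma>(1) True lookup_add lookup_unit_index distrib_right)
  next
    case False
    have "of_nat ?c * pdiff (\<gamma> - unit_index j + unit_index i) g = of_nat ?c * pdiff (\<gamma> + unit_index i - unit_index j) g"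
    proof (cases "?c = 0")
      case c: False
      have "\<gamma> - unit_index j + unit_index i = \<gamma> + unit_index i - unit_index j"
        using c False
        by (intro poly_mapping_eqI) (auto simp: lookup_add lookup_minus lookup_unit_index)
      then show ?thesis by simp
    qed simp
    then show ?thesis using False by (simp add: \<gamma>(1) lookup_add lookup_unit_index pdiff_add_unit)
  qed
  have "pdiff \<beta> (t j * g) - of_nat (Poly_Mapping.lookup \<beta> j) * pdiff (\<beta> - unit_index j) g =
     (pdiff \<gamma> (partial i (t j) * g) - partial i (t j) * pdiff \<gamma> g)
     + (partial i (t j) - of_bool (i = j)) * pdiff \<gamma> g
     + (pdiff \<gamma> (t j * partial i g) - of_nat ?c * pdiff (\<gamma> - unit_index j) (partial i g))"
    unfolding 4 by (simp add: \<gamma>(1) pdiff_add_unit partial_mult pdiff_add left_diff_distrib)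
  also have "\<dots> \<in> P" by (intro P_add 1 2 3)
  finally show ?case .
qed

section \<open>Monomials in the local parameters\<close>

definition tpow :: "('n \<Rightarrow>\<^sub>0 nat) \<Rightarrow> ('n, 'k) mpoly" where
  "tpow \<alpha> = (\<Prod>i\<in>UNIV. t i ^ Poly_Mapping.lookup \<alpha> i)"

lemma tpow_0: "tpow 0 = 1"
  by (simp add: tpow_def)

lemma tpow_add_unit: "tpow (\<alpha> + unit_index j) = t j * tpow \<alpha>"
proof -
  have "t i ^ Poly_Mapping.lookup (\<alpha> + unit_index j) i
      = (if i = j then t j else 1) * t i ^ Poly_Mapping.lookup \<alpha> i" for i
    by (simp add: lookup_add lookup_unit_index)
  then show ?thesis by (simp add: tpow_def prod.distrib prod.delta)
qed

lemma tpow_dpow: "tpow \<alpha> \<in> dpow (index_deg \<alpha>)"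
proof (induction "index_deg \<alpha>" arbitrary: \<alpha>)
  case 0
  then show ?case by (metis dpow_0)
next
  case (Suc m)
  obtain \<beta> i where \<beta>: "\<alpha> = \<beta> + unit_index i" "index_deg \<beta> = m"
    using index_deg_Suc[OF Suc.hyps(2)[symmetric]] .
  have "t i * tpow \<beta> \<in> dpow (Suc m)"
    using Suc.hyps(1)[of \<beta>] \<beta>(2) by (intro dpow_mult_P t_P) simp
  moreover have "index_deg \<alpha> = Suc m" using Suc.hyps(2) by simp
  ultimately show ?case using \<beta>(1) by (simp only: tpow_add_unit)
qed

text \<open>The derivatives of order \<open>m\<close> of the monomials of degree \<open>m\<close>
  form a diagonal matrix modulo \<open>P\<close>. Peeling off the factors \<open>t j\<close>
  collects positive integers on the diagonal, and these are units in characteristic 0.\<close>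

lemma pdiff_tpow:
  "index_deg \<beta> = index_deg \<alpha> \<Longrightarrow> pdiff \<beta> (tpow \<alpha>) \<in> P \<longleftrightarrow> \<beta> \<noteq> \<alpha>"
proof (induction "index_deg \<alpha>" arbitrary: \<alpha> \<beta>)
  case 0
  then have "\<alpha> = 0" "\<beta> = 0" using index_deg_eq_0 by metis+
  then show ?case by (simp add: tpow_0 one_notin_P)
next
  case (Suc m)
  obtain \<alpha>' j where \<alpha>: "\<alpha> = \<alpha>' + unit_index j" "index_deg \<alpha>' = m"
    using index_deg_Suc[OF Suc.hyps(2)[symmetric]] .
  have "pdiff \<beta> (t j * tpow \<alpha>') - of_nat (Poly_Mapping.lookup \<beta> j) * pdiff (\<beta> - unit_index j) (tpow \<alpha>') \<in> P"
  proof (rule pdiff_t_mult)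
    show "tpow \<alpha>' \<in> dpow m" using tpow_dpow[of \<alpha>'] \<alpha>(2) by simp
    show "index_deg \<beta> = Suc m" using Suc.prems Suc.hyps(2) by linarith
  qed
  then have iff: "pdiff \<beta> (tpow \<alpha>) \<in> P \<longleftrightarrow>
      of_nat (Poly_Mapping.lookup \<beta> j) * pdiff (\<beta> - unit_index j) (tpow \<alpha>') \<in> P"
    unfolding \<alpha>(1) tpow_add_unit by (rule P_cong)
  show ?case
  proof (cases "Poly_Mapping.lookup \<beta> j = 0")
    case True
    then have "\<beta> \<noteq> \<alpha>" by (auto simp: \<alpha>(1) lookup_add lookup_unit_index)
    then show ?thesis using True by (simp add: iff P_0)
  next
    case False
    then have \<beta>: "\<beta> - unit_index j + unit_index j = \<beta>" by (intro index_minus_unit) simp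
    have "index_deg \<beta> = index_deg (\<beta> - unit_index j) + 1"
      using index_deg_add[of "\<beta> - unit_index j" "unit_index j"] by (simp add: \<beta>)
    then have "index_deg (\<beta> - unit_index j) = index_deg \<alpha>'"
      using Suc.prems Suc.hyps(2) \<alpha>(2) by simp
    from Suc.hyps(1)[OF \<alpha>(2)[symmetric] this]
    have "pdiff (\<beta> - unit_index j) (tpow \<alpha>') \<in> P \<longleftrightarrow> \<beta> - unit_index j \<noteq> \<alpha>'" .
    moreover have "\<beta> - unit_index j = \<alpha>' \<longleftrightarrow> \<beta> = \<alpha>" using \<beta> \<alpha>(1) by auto
    moreover have "of_nat (Poly_Mapping.lookup \<beta> j) \<notin> P" using False by (intro of_nat_notin_P) simp
    ultimately show ?thesis by (simp add: iff prime_P)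
  qed
qed

lemma pdiff_sum_tpow:
  assumes \<beta>: "index_deg \<beta> = m"
  shows "pdiff \<beta> (\<Sum>\<alpha> | index_deg \<alpha> = m. h \<alpha> * tpow \<alpha>) - h \<beta> * pdiff \<beta> (tpow \<beta>) \<in> P"
proof -
  let ?M = "{\<alpha> :: 'n \<Rightarrow>\<^sub>0 nat. index_deg \<alpha> = m}"
  have 1: "pdiff \<beta> (h \<alpha> * tpow \<alpha>) - h \<alpha> * pdiff \<beta> (tpow \<alpha>) \<in> P" if "\<alpha> \<in> ?M" for \<alpha>
    using tpow_dpow[of \<alpha>] that \<beta> by (intro pdiff_mult_dpow) simp_all
  have "(\<Sum>\<alpha>\<in>?M - {\<beta>}. pdiff \<beta> (h \<alpha> * tpow \<alpha>)) \<in> P"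
  proof (rule P_sum)
    fix \<alpha> assume \<alpha>: "\<alpha> \<in> ?M - {\<beta>}"
    then have "h \<alpha> * pdiff \<beta> (tpow \<alpha>) \<in> P" using pdiff_tpow[of \<beta> \<alpha>] \<beta> by (intro P_mult) auto
    then show "pdiff \<beta> (h \<alpha> * tpow \<alpha>) \<in> P" using 1[of \<alpha>] \<alpha> P_cong by blast
  qed
  then have "(pdiff \<beta> (h \<beta> * tpow \<beta>) - h \<beta> * pdiff \<beta> (tpow \<beta>))
      + (\<Sum>\<alpha>\<in>?M - {\<beta>}. pdiff \<beta> (h \<alpha> * tpow \<alpha>)) \<in> P"
    using 1[of \<beta>] \<beta> by (intro P_add) simp_all
  then show ?thesis
    using \<beta> by (simp add: pdiff_sum pdiff_add finite_index_deg sum.remove[of ?M \<beta>] diff_add_eq)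
qed

text \<open>In a representation of degree \<open>m\<close>, the vanishing derivatives of order
  \<open>m\<close> force every coefficient \<open>h \<alpha>\<close> into \<open>P\<close> by
  diagonality. Elements of \<open>P\<close> are locally combinations of the \<open>t j\<close>,
  which raises the degree by one.\<close>

lemma dpow_subset_localize: "f \<in> dpow m \<Longrightarrow> f \<in> localize (span_ideal {\<alpha>. index_deg \<alpha> = m} tpow)"
proof (induction m arbitrary: f)
  case 0
  let ?L = "span_ideal {\<alpha> :: 'n \<Rightarrow>\<^sub>0 nat. index_deg \<alpha> = 0} tpow"
  have "tpow 0 \<in> ?L" by (intro span_ideal_base finite_index_deg) simp
  then have "f * tpow 0 \<in> ?L" using is_ideal_span_ideal unfolding is_ideal_def by blast
  then show ?case by (intro localize_base) (simp add: tpow_0)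
next
  case (Suc m)
  let ?L = "span_ideal {\<alpha> :: 'n \<Rightarrow>\<^sub>0 nat. index_deg \<alpha> = Suc m} tpow"
  have "f \<in> localize (span_ideal {\<alpha>. index_deg \<alpha> = m} tpow)"
    using Suc.prems by (intro Suc.IH dpow_antimono[OF Suc.prems]) simp
  then obtain s h where s: "s \<notin> P" and h: "s * f = (\<Sum>\<alpha> | index_deg \<alpha> = m. h \<alpha> * tpow \<alpha>)"
    by (auto simp: localize_def span_ideal_def)
  have hP: "h \<beta> \<in> P" if \<beta>: "index_deg \<beta> = m" for \<beta>
  proof -
    have "pdiff \<beta> (s * f) \<in> P" by (rule dpowD[OF dpow_mult[OF Suc.prems]]) (simp add: \<beta>)
    then have "h \<beta> * pdiff \<beta> (tpow \<beta>) \<in> P"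
      using P_cong[OF pdiff_sum_tpow[OF \<beta>, of h]] unfolding h by blast
    then show ?thesis using pdiff_tpow[of \<beta> \<beta>] by (simp add: prime_P)
  qed
  have L: "is_ideal (localize ?L)" by (intro is_ideal_localize is_ideal_span_ideal)
  have "h \<beta> * tpow \<beta> \<in> localize ?L" if \<beta>: "index_deg \<beta> = m" for \<beta>
  proof -
    obtain s' r where s': "s' \<notin> P" and r: "s' * h \<beta> = (\<Sum>j\<in>UNIV. r j * t j)"
      using P_localize_t[OF hP[OF \<beta>]] by (auto simp: localize_def span_ideal_def)
    have "s' * (h \<beta> * tpow \<beta>) = (\<Sum>j\<in>UNIV. r j * tpow (\<beta> + unit_index j))"
      by (simp add: r tpow_add_unit sum_distrib_right mult.assoc flip: mult.assoc[of s'])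
    also have "\<dots> \<in> ?L"
    proof (rule ideal_sum[OF is_ideal_span_ideal])
      fix j
      have "tpow (\<beta> + unit_index j) \<in> ?L"
        by (intro span_ideal_base finite_index_deg) (simp add: index_deg_add \<beta>)
      then show "r j * tpow (\<beta> + unit_index j) \<in> ?L"
        using is_ideal_span_ideal unfolding is_ideal_def by blast
    qed
    finally show ?thesis by (rule localizeI[OF s'])
  qed
  then have "s * f \<in> localize ?L" unfolding h by (intro ideal_sum[OF L]) simp
  then show ?case by (rule localize_cancel[OF s])
qed

text \<open>Solved order by order: adding a form of degree \<open>m\<close> in \<open>t\<close> does
  not disturb lower orders modulo \<open>P\<close>, and in order \<open>m\<close> the system is
  diagonal with invertible entries.\<close>

lemma taylor_surjective: "\<exists>g. \<forall>\<beta>. index_deg \<beta> < m \<longrightarrow> pdiff \<beta> g - c \<beta> \<in> P"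
proof (induction m)
  case (Suc m)
  then obtain g where g: "\<And>\<beta>. index_deg \<beta> < m \<Longrightarrow> pdiff \<beta> g - c \<beta> \<in> P" by blast
  have "\<exists>w. pdiff \<alpha> (tpow \<alpha>) * w - 1 \<in> P" for \<alpha>
    using inverse_mod[of "pdiff \<alpha> (tpow \<alpha>)"] pdiff_tpow[of \<alpha> \<alpha>] by metis
  then obtain w where w: "\<And>\<alpha>. pdiff \<alpha> (tpow \<alpha>) * w \<alpha> - 1 \<in> P" by metis
  define h where "h \<alpha> = (c \<alpha> - pdiff \<alpha> g) * w \<alpha>" for \<alpha>
  define S where "S = (\<Sum>\<alpha> | index_deg \<alpha> = m. h \<alpha> * tpow \<alpha>)"
  have S: "S \<in> dpow m"
    unfolding S_def
  proof (rule dpow_sum)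
    fix \<alpha> :: "'n \<Rightarrow>\<^sub>0 nat" assume "\<alpha> \<in> {\<alpha>. index_deg \<alpha> = m}"
    then show "h \<alpha> * tpow \<alpha> \<in> dpow m" using tpow_dpow[of \<alpha>] by (intro dpow_mult) simp
  qed
  have "pdiff \<beta> (g + S) - c \<beta> \<in> P" if \<beta>: "index_deg \<beta> < Suc m" for \<beta>
  proof (cases "index_deg \<beta> < m")
    case True
    have "(pdiff \<beta> g - c \<beta>) + pdiff \<beta> S \<in> P" by (intro P_add g dpowD[OF S] True)
    then show ?thesis by (simp add: pdiff_add algebra_simps)
  next
    case False
    then have \<beta>: "index_deg \<beta> = m" using \<beta> by simp
    have 1: "pdiff \<beta> S - h \<beta> * pdiff \<beta> (tpow \<beta>) \<in> P"
      unfolding S_def by (rule pdiff_sum_tpow[OF \<beta>])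
    have "pdiff \<beta> (g + S) - c \<beta> = (pdiff \<beta> S - h \<beta> * pdiff \<beta> (tpow \<beta>))
        + (c \<beta> - pdiff \<beta> g) * (pdiff \<beta> (tpow \<beta>) * w \<beta> - 1)"
      by (simp add: h_def pdiff_add algebra_simps)
    also have "\<dots> \<in> P" by (intro P_add P_mult 1 w)
    finally show ?thesis .
  qed
  then show ?case by blast
qed simp

text \<open>Pigeonhole: some power of each \<open>t i\<close> lies in \<open>I\<close>, and a
  monomial of large degree contains one of these powers. The factor outside \<open>P\<close> left by
  the localization is cancelled because \<open>I\<close> is \<open>P\<close>-primary.\<close>

lemma dpow_subset_primary:
  assumes I: "P_primary P I"
  obtains m where "dpow m \<subseteq> I"
proof -
  have idl: "is_ideal I" and rad: "radical I = P"
    and prim: "\<And>a b. a * b \<in> I \<Longrightarrow> a \<notin> I \<Longrightarrow> b \<in> P"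
    using I by (auto simp: P_primary_def primary_ideal_def)
  have "\<exists>k. t i ^ k \<in> I" for i using t_P[of i] by (simp add: radical_def flip: rad)
  then obtain k where k: "\<And>i. t i ^ k i \<in> I" by metis
  define m where "m = Suc (\<Sum>i\<in>UNIV. k i)"
  have tI: "tpow \<alpha> \<in> I" if \<alpha>: "index_deg \<alpha> = m" for \<alpha>
  proof -
    have "\<exists>i. k i \<le> Poly_Mapping.lookup \<alpha> i"
    proof (rule ccontr)
      assume "\<not> ?thesis"
      then have "Poly_Mapping.lookup \<alpha> i \<le> k i" for i by (meson nat_le_linear)
      then have "index_deg \<alpha> \<le> (\<Sum>i\<in>UNIV. k i)" unfolding index_deg_def by (intro sum_mono)
      then show False using \<alpha> by (simp add: m_def)
    qed
    then obtain i where i: "k i \<le> Poly_Mapping.lookup \<alpha> i" by blast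
    have "t i ^ Poly_Mapping.lookup \<alpha> i = t i ^ (Poly_Mapping.lookup \<alpha> i - k i) * t i ^ k i"
      using i by (simp flip: power_add)
    moreover have "tpow \<alpha> = (\<Prod>j\<in>UNIV - {i}. t j ^ Poly_Mapping.lookup \<alpha> j) * t i ^ Poly_Mapping.lookup \<alpha> i"
      unfolding tpow_def by (subst prod.remove[of _ i]) (simp_all add: mult.commute)
    ultimately have "tpow \<alpha> = ((\<Prod>j\<in>UNIV - {i}. t j ^ Poly_Mapping.lookup \<alpha> j)
        * t i ^ (Poly_Mapping.lookup \<alpha> i - k i)) * t i ^ k i"
      by (simp add: mult.assoc)
    then show ?thesis using idl k[of i] by (simp add: is_ideal_def)
  qed
  have sub: "span_ideal {\<alpha>. index_deg \<alpha> = m} tpow \<subseteq> I"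
    using tI by (intro span_ideal_least[OF idl]) simp
  have "dpow m \<subseteq> I"
  proof
    fix f assume "f \<in> dpow m"
    then obtain s where "s \<notin> P" "s * f \<in> I"
      using dpow_subset_localize[of f m] sub by (auto simp: localize_def)
    then show "f \<in> I" using prim[of f s] by (auto simp: mult.commute)
  qed
  then show ?thesis by (rule that)
qed

end

section \<open>Duality\<close>

lemma wact_superset:
  assumes "finite S" "Poly_Mapping.keys D \<subseteq> S"
  shows "wact D f = (\<Sum>\<alpha>\<in>S. Poly_Mapping.lookup D \<alpha> * pdiff \<alpha> f)"
  unfolding wact_def using assms by (intro sum.mono_neutral_left) (auto simp: in_keys_iff)

lemma wact_add: "wact (D + E) f = wact D f + wact E f"
proof -
  let ?S = "Poly_Mapping.keys D \<union> Poly_Mapping.keys E"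
  show ?thesis
    using Poly_Mapping.keys_add[of D E]
    by (simp add: wact_superset[of ?S] lookup_add distrib_right sum.distrib)
qed

lemma wact_sum: "wact (\<Sum>E\<in>F. g E) f = (\<Sum>E\<in>F. wact (g E) f)"
  by (induction F rule: infinite_finite_induct) (simp_all add: wact_add, simp_all add: wact_def)

lemma lookup_wscale: "Poly_Mapping.lookup (wscale r D) \<alpha> = r * Poly_Mapping.lookup D \<alpha>"
  by (simp add: wscale_def Poly_Mapping.map.rep_eq when_def)

lemma wact_wscale: "wact (wscale r D) f = r * wact D f"
proof -
  have "Poly_Mapping.keys (wscale r D) \<subseteq> Poly_Mapping.keys D"
    by (auto simp: in_keys_iff lookup_wscale)
  then show ?thesis
    by (simp add: wact_superset[of "Poly_Mapping.keys D"] lookup_wscale sum_distrib_left mult.assoc)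
qed

lemma keys_index_deg_bound:
  fixes D :: "('n::finite, 'k::comm_ring_1) weyl"
  obtains M where "M \<ge> m" "Poly_Mapping.keys D \<subseteq> {\<alpha>. index_deg \<alpha> < M}"
proof (rule that)
  let ?M = "Suc (m + (\<Sum>\<alpha>\<in>Poly_Mapping.keys D. index_deg \<alpha>))"
  show "?M \<ge> m" by simp
  show "Poly_Mapping.keys D \<subseteq> {\<alpha>. index_deg \<alpha> < ?M}"
  proof
    fix \<alpha> assume "\<alpha> \<in> Poly_Mapping.keys D"
    then have "index_deg \<alpha> \<le> (\<Sum>\<alpha>\<in>Poly_Mapping.keys D. index_deg \<alpha>)"
      by (intro member_le_sum) simp_all
    then show "\<alpha> \<in> {\<alpha>. index_deg \<alpha> < ?M}" by simp
  qed
qed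

context mpoly_max_ideal
begin

lemma wact_same_image: assumes "same_image P D E" shows "wact D f - wact E f \<in> P"
proof -
  let ?S = "Poly_Mapping.keys D \<union> Poly_Mapping.keys E"
  have "wact D f - wact E f = (\<Sum>\<alpha>\<in>?S. (Poly_Mapping.lookup D \<alpha> - Poly_Mapping.lookup E \<alpha>) * pdiff \<alpha> f)"
    by (simp add: wact_superset[of ?S] left_diff_distrib sum_subtractf)
  also have "\<dots> \<in> P" using assms by (intro P_sum P_mult2) (simp add: same_image_def)
  finally show ?thesis .
qed

lemma wact_kspan:
  assumes D: "D \<in> kspan P N" and N: "\<And>E. E \<in> N \<Longrightarrow> wact E f \<in> P"
  shows "wact D f \<in> P"
proof -
  obtain F c where F: "F \<subseteq> N" and D: "same_image P D (\<Sum>E\<in>F. wscale (c E) E)"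
    using D by (auto simp: kspan_def)
  have "wact (\<Sum>E\<in>F. wscale (c E) E) f \<in> P"
    unfolding wact_sum wact_wscale by (intro P_sum P_mult N) (use F in blast)
  then show ?thesis using P_cong[OF wact_same_image[OF D]] by blast
qed

end

context mpoly_local_parameters
begin

text \<open>A polynomial \<open>g\<close> whose only nonzero Taylor coefficient is a 1 at
  \<open>\<alpha>\<close>, up to an order \<open>M\<close> beyond that of \<open>E\<close>, makes
  \<open>E\<close> return this coefficient modulo \<open>P\<close>. Since \<open>\<alpha>\<close>
  has order at least \<open>m\<close>, \<open>g\<close> lies in \<open>dpow m\<close> and hence in
  \<open>I\<close>.\<close>

lemma lookup_local_dual:
  assumes I: "dpow m \<subseteq> I" and E: "E \<in> local_dual P I" and \<alpha>: "index_deg \<alpha> \<ge> m"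
  shows "Poly_Mapping.lookup E \<alpha> \<in> P"
proof -
  obtain M where M: "M \<ge> Suc (index_deg \<alpha>)" "Poly_Mapping.keys E \<subseteq> {\<alpha>. index_deg \<alpha> < M}"
    by (rule keys_index_deg_bound)
  let ?B = "{\<alpha> :: 'n \<Rightarrow>\<^sub>0 nat. index_deg \<alpha> < M}"
  obtain g where g: "\<And>\<beta>. index_deg \<beta> < M \<Longrightarrow> pdiff \<beta> g - of_bool (\<beta> = \<alpha>) \<in> P"
    using taylor_surjective[of M "\<lambda>\<beta>. of_bool (\<beta> = \<alpha>)"] by blast
  have "g \<in> dpow m"
    unfolding dpow_def
  proof (intro CollectI allI impI)
    fix \<beta> :: "'n \<Rightarrow>\<^sub>0 nat" assume "index_deg \<beta> < m"
    then have "\<beta> \<noteq> \<alpha>" "index_deg \<beta> < M" using \<alpha> M(1) by auto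
    then show "pdiff \<beta> g \<in> P" using g[of \<beta>] by simp
  qed
  then have 1: "wact E g \<in> P" using I E by (auto simp: local_dual_def)
  have 2: "(\<Sum>\<beta>\<in>?B. Poly_Mapping.lookup E \<beta> * (pdiff \<beta> g - of_bool (\<beta> = \<alpha>))) \<in> P"
    by (intro P_sum P_mult g) simp
  have "(\<Sum>\<beta>\<in>?B. Poly_Mapping.lookup E \<beta> * of_bool (\<beta> = \<alpha>)) = Poly_Mapping.lookup E \<alpha>"
  proof -
    have "Poly_Mapping.lookup E \<beta> * of_bool (\<beta> = \<alpha>) = (if \<beta> = \<alpha> then Poly_Mapping.lookup E \<beta> else 0)" for \<beta>
      by simp
    then show ?thesis using M(1) by (simp only: sum.delta[OF finite_index_deg_less]) simp
  qed
  then have "Poly_Mapping.lookup E \<alpha> = wact E g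
      - (\<Sum>\<beta>\<in>?B. Poly_Mapping.lookup E \<beta> * (pdiff \<beta> g - of_bool (\<beta> = \<alpha>)))"
    by (simp only: wact_superset[OF finite_index_deg_less M(2)] right_diff_distrib sum_subtractf) simp
  then show ?thesis using P_diff[OF 1 2] by simp
qed

lemma wact_local_dual:
  assumes I: "dpow m \<subseteq> I" and E: "E \<in> local_dual P I"
  shows "wact E f - (\<Sum>\<alpha> | index_deg \<alpha> < m. Poly_Mapping.lookup E \<alpha> * pdiff \<alpha> f) \<in> P"
proof -
  obtain M where M: "M \<ge> m" "Poly_Mapping.keys E \<subseteq> {\<alpha>. index_deg \<alpha> < M}"
    by (rule keys_index_deg_bound)
  let ?B = "{\<alpha> :: 'n \<Rightarrow>\<^sub>0 nat. index_deg \<alpha> < M}" and ?A = "{\<alpha> :: 'n \<Rightarrow>\<^sub>0 nat. index_deg \<alpha> < m}"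
  have "wact E f = (\<Sum>\<alpha>\<in>?B - ?A. Poly_Mapping.lookup E \<alpha> * pdiff \<alpha> f)
      + (\<Sum>\<alpha>\<in>?A. Poly_Mapping.lookup E \<alpha> * pdiff \<alpha> f)"
    unfolding wact_superset[OF finite_index_deg_less M(2)]
    using M(1) by (intro sum.subset_diff finite_index_deg_less) auto
  moreover have "(\<Sum>\<alpha>\<in>?B - ?A. Poly_Mapping.lookup E \<alpha> * pdiff \<alpha> f) \<in> P"
    by (intro P_sum P_mult2 lookup_local_dual[OF I E]) simp
  ultimately show ?thesis by simp
qed

text \<open>\<open>S\<close> below consists of the truncated Taylor vectors of \<open>I\<close>. As
  \<open>I\<close> contains \<open>dpow m\<close>, the vector of \<open>f\<close> is outside
  \<open>S\<close>, and the entries of a separating form are the coefficients of the desired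
  operator.\<close>

lemma local_dual_separates:
  assumes idl: "is_ideal I" and I: "dpow m \<subseteq> I" and f: "f \<notin> I"
  shows "\<exists>D\<in>local_dual P I. wact D f \<notin> P"
proof -
  let ?B = "{\<alpha> :: 'n \<Rightarrow>\<^sub>0 nat. index_deg \<alpha> < m}"
  have I_mult: "r * g \<in> I" if "g \<in> I" for r g using idl that by (simp add: is_ideal_def)
  have I_add: "g + h \<in> I" if "g \<in> I" "h \<in> I" for g h using idl that by (simp add: is_ideal_def)
  have I_diff: "g - h \<in> I" if "g \<in> I" "h \<in> I" for g h
    using I_add[OF that(1) I_mult[OF that(2), of "- 1"]] by simp
  define S where "S = {s. \<exists>g\<in>I. \<forall>\<alpha>\<in>?B. s \<alpha> - pdiff \<alpha> g \<in> P}"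
  have "\<exists>v. (\<forall>s\<in>S. (\<Sum>\<alpha>\<in>?B. s \<alpha> * v \<alpha>) \<in> P) \<and> (\<Sum>\<alpha>\<in>?B. pdiff \<alpha> f * v \<alpha>) \<notin> P"
  proof (rule separating_vector)
    show "finite ?B" by (rule finite_index_deg_less)
  next
    fix s s' assume "s \<in> S" "s' \<in> S"
    then obtain g g' where g: "g \<in> I" "g' \<in> I" "\<forall>\<alpha>\<in>?B. s \<alpha> - pdiff \<alpha> g \<in> P"
      "\<forall>\<alpha>\<in>?B. s' \<alpha> - pdiff \<alpha> g' \<in> P" unfolding S_def by blast
    have "s \<alpha> - s' \<alpha> - pdiff \<alpha> (g - g') \<in> P" if "\<alpha> \<in> ?B" for \<alpha>
    proof -
      have "(s \<alpha> - pdiff \<alpha> g) - (s' \<alpha> - pdiff \<alpha> g') \<in> P"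
        using P_diff[OF bspec[OF g(3) that] bspec[OF g(4) that]] .
      then show ?thesis by (simp add: pdiff_diff algebra_simps)
    qed
    then show "(\<lambda>\<alpha>. s \<alpha> - s' \<alpha>) \<in> S" unfolding S_def using I_diff[OF g(1,2)] by blast
  next
    fix r s assume "s \<in> S"
    then obtain g where g: "g \<in> I" "\<And>\<alpha>. \<alpha> \<in> ?B \<Longrightarrow> s \<alpha> - pdiff \<alpha> g \<in> P" unfolding S_def by blast
    \<comment> \<open>The product \<open>r * g\<close> would not do, because the product rule also
      differentiates \<open>r\<close>.\<close>
    obtain \<rho> where \<rho>: "\<And>\<beta>. index_deg \<beta> < m \<Longrightarrow> pdiff \<beta> \<rho> - (if \<beta> = 0 then r else 0) \<in> P"
      using taylor_surjective[of m "\<lambda>\<beta>. if \<beta> = 0 then r else 0"] by blast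
    have "r * s \<alpha> - pdiff \<alpha> (\<rho> * g) \<in> P" if \<alpha>: "\<alpha> \<in> ?B" for \<alpha>
    proof -
      have d: "partial i \<rho> \<in> dpow (index_deg \<alpha>)" for i
        unfolding dpow_def
      proof (intro CollectI allI impI)
        fix \<beta> :: "'n \<Rightarrow>\<^sub>0 nat" assume \<beta>: "index_deg \<beta> < index_deg \<alpha>"
        have "index_deg (\<beta> + unit_index i) = Suc (index_deg \<beta>)" by (simp add: index_deg_add)
        then have "\<beta> + unit_index i \<noteq> 0" "index_deg (\<beta> + unit_index i) < m"
          using \<beta> \<alpha> by (metis index_deg_0 nat.distinct(1), simp)
        then show "pdiff \<beta> (partial i \<rho>) \<in> P"
          using \<rho>[of "\<beta> + unit_index i"] by (simp add: pdiff_add_unit)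
      qed
      have 1: "pdiff \<alpha> (\<rho> * g) - \<rho> * pdiff \<alpha> g \<in> P" by (rule pdiff_mult_constant[OF refl d])
      have 2: "\<rho> - r \<in> P" using \<rho>[of 0] \<alpha> by simp
      have "r * s \<alpha> - pdiff \<alpha> (\<rho> * g) = r * (s \<alpha> - pdiff \<alpha> g)
          - ((\<rho> - r) * pdiff \<alpha> g + (pdiff \<alpha> (\<rho> * g) - \<rho> * pdiff \<alpha> g))"
        by (simp add: algebra_simps)
      also have "\<dots> \<in> P" by (rule P_diff[OF P_mult[OF g(2)[OF \<alpha>]] P_add[OF P_mult2[OF 2] 1]])
      finally show ?thesis .
    qed
    then show "(\<lambda>\<alpha>. r * s \<alpha>) \<in> S" unfolding S_def using I_mult[OF g(1)] by blast
  next
    fix s assume "\<forall>\<alpha>\<in>?B. s \<alpha> \<in> P"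
    then show "s \<in> S" unfolding S_def using idl by (intro CollectI bexI[of _ 0]) (simp_all add: is_ideal_def)
  next
    show "(\<lambda>\<alpha>. pdiff \<alpha> f) \<notin> S"
    proof
      assume "(\<lambda>\<alpha>. pdiff \<alpha> f) \<in> S"
      then obtain g where g: "g \<in> I" "\<forall>\<alpha>\<in>?B. pdiff \<alpha> f - pdiff \<alpha> g \<in> P" unfolding S_def by blast
      then have "f - g \<in> dpow m" by (simp add: dpow_def pdiff_diff)
      then have "(f - g) + g \<in> I" using I g(1) by (intro I_add) blast+
      then show False using f by simp
    qed
  qed
  then obtain v where v: "\<And>s. s \<in> S \<Longrightarrow> (\<Sum>\<alpha>\<in>?B. s \<alpha> * v \<alpha>) \<in> P" "(\<Sum>\<alpha>\<in>?B. pdiff \<alpha> f * v \<alpha>) \<notin> P"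
    by blast
  define D where "D = (\<Sum>\<alpha>\<in>?B. Poly_Mapping.single \<alpha> (v \<alpha>))"
  have l: "Poly_Mapping.lookup D \<beta> = (if \<beta> \<in> ?B then v \<beta> else 0)" for \<beta>
    by (simp only: D_def lookup_sum lookup_single when_def sum.delta[OF finite_index_deg_less])
  have keys: "Poly_Mapping.keys D \<subseteq> ?B" by (auto simp: in_keys_iff l split: if_splits)
  have w: "wact D g = (\<Sum>\<alpha>\<in>?B. pdiff \<alpha> g * v \<alpha>)" for g
    unfolding wact_superset[OF finite_index_deg_less keys] by (intro sum.cong) (simp_all add: l mult.commute)
  have "D \<in> local_dual P I"
    unfolding local_dual_def
  proof (intro CollectI ballI)
    fix g assume "g \<in> I"
    then have "(\<lambda>\<alpha>. pdiff \<alpha> g) \<in> S" unfolding S_def by (intro CollectI bexI[of _ g]) (simp_all add: P_0)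
    then show "wact D g \<in> P" unfolding w by (rule v(1))
  qed
  then show ?thesis using v(2) w by metis
qed

text \<open>The converse use of separation: a vector that annihilates the span of \<open>N\<close>
  but not \<open>D\<close> is realised as the Taylor vector of some \<open>f\<close>. Then
  \<open>N\<close> kills \<open>f\<close>, so \<open>f\<close> is in \<open>I\<close>, and
  \<open>D\<close> must kill it as well.\<close>

lemma local_dual_subset_kspan:
  assumes I: "dpow m \<subseteq> I" and N: "\<And>f. f \<in> I \<longleftrightarrow> (\<forall>E\<in>N. wact E f \<in> P)"
  shows "local_dual P I \<subseteq> kspan P N"
proof
  fix D assume D: "D \<in> local_dual P I"
  let ?B = "{\<alpha> :: 'n \<Rightarrow>\<^sub>0 nat. index_deg \<alpha> < m}"
  let ?comb = "\<lambda>F c \<alpha>. \<Sum>E\<in>F. c E * Poly_Mapping.lookup E \<alpha>"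
  have N_dual: "E \<in> local_dual P I" if "E \<in> N" for E using N that by (auto simp: local_dual_def)
  define S where "S = {s. \<exists>F c. finite F \<and> F \<subseteq> N \<and> (\<forall>\<alpha>\<in>?B. s \<alpha> - ?comb F c \<alpha> \<in> P)}"
  have S_I: "s \<in> S" if "finite F" "F \<subseteq> N" "\<And>\<alpha>. \<alpha> \<in> ?B \<Longrightarrow> s \<alpha> - ?comb F c \<alpha> \<in> P" for s F c
    unfolding S_def using that by blast
  show "D \<in> kspan P N"
  proof (rule ccontr)
    assume nD: "D \<notin> kspan P N"
    have "\<exists>v. (\<forall>s\<in>S. (\<Sum>\<alpha>\<in>?B. s \<alpha> * v \<alpha>) \<in> P) \<and> (\<Sum>\<alpha>\<in>?B. Poly_Mapping.lookup D \<alpha> * v \<alpha>) \<notin> P"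
    proof (rule separating_vector)
      show "finite ?B" by (rule finite_index_deg_less)
    next
      fix s s' assume "s \<in> S" "s' \<in> S"
      then obtain F c F' c' where F: "finite F" "F \<subseteq> N" "\<And>\<alpha>. \<alpha> \<in> ?B \<Longrightarrow> s \<alpha> - ?comb F c \<alpha> \<in> P"
        and F': "finite F'" "F' \<subseteq> N" "\<And>\<alpha>. \<alpha> \<in> ?B \<Longrightarrow> s' \<alpha> - ?comb F' c' \<alpha> \<in> P"
        unfolding S_def by blast
      define b where "b E = (if E \<in> F then c E else 0) - (if E \<in> F' then c' E else 0)" for E
      have ext: "?comb H e \<alpha> = (\<Sum>E\<in>F \<union> F'. (if E \<in> H then e E else 0) * Poly_Mapping.lookup E \<alpha>)"
        if "H \<subseteq> F \<union> F'" for H e \<alpha>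
        using that F F' by (intro sum.mono_neutral_cong_left) auto
      have b: "?comb (F \<union> F') b \<alpha> = ?comb F c \<alpha> - ?comb F' c' \<alpha>" for \<alpha>
        unfolding ext[of F c \<alpha>, OF Un_upper1] ext[of F' c' \<alpha>, OF Un_upper2]
        by (simp only: b_def left_diff_distrib sum_subtractf)
      show "(\<lambda>\<alpha>. s \<alpha> - s' \<alpha>) \<in> S"
      proof (rule S_I)
        show "finite (F \<union> F')" "F \<union> F' \<subseteq> N" using F F' by auto
        fix \<alpha> assume \<alpha>: "\<alpha> \<in> ?B"
        have "(s \<alpha> - ?comb F c \<alpha>) - (s' \<alpha> - ?comb F' c' \<alpha>) \<in> P"
          by (rule P_diff[OF F(3)[OF \<alpha>] F'(3)[OF \<alpha>]])
        then show "s \<alpha> - s' \<alpha> - ?comb (F \<union> F') b \<alpha> \<in> P" unfolding b by (simp add: algebra_simps)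
      qed
    next
      fix r s assume "s \<in> S"
      then obtain F c where F: "finite F" "F \<subseteq> N" "\<And>\<alpha>. \<alpha> \<in> ?B \<Longrightarrow> s \<alpha> - ?comb F c \<alpha> \<in> P"
        unfolding S_def by blast
      show "(\<lambda>\<alpha>. r * s \<alpha>) \<in> S"
      proof (rule S_I[OF F(1,2)])
        fix \<alpha> assume "\<alpha> \<in> ?B"
        then have "r * (s \<alpha> - ?comb F c \<alpha>) \<in> P" by (intro P_mult F)
        then show "r * s \<alpha> - ?comb F (\<lambda>E. r * c E) \<alpha> \<in> P"
          by (simp add: right_diff_distrib sum_distrib_left mult.assoc)
      qed
    next
      fix s assume "\<forall>\<alpha>\<in>?B. s \<alpha> \<in> P"
      then show "s \<in> S" by (intro S_I[of "{}"]) simp_all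
    next
      show "Poly_Mapping.lookup D \<notin> S"
      proof
        assume "Poly_Mapping.lookup D \<in> S"
        then obtain F c where F: "finite F" "F \<subseteq> N"
          "\<And>\<alpha>. \<alpha> \<in> ?B \<Longrightarrow> Poly_Mapping.lookup D \<alpha> - ?comb F c \<alpha> \<in> P"
          unfolding S_def by blast
        \<comment> \<open>Agreement in orders below \<open>m\<close> suffices, since all operators
          involved lie in the dual space and have their higher coefficients in
          \<open>P\<close>.\<close>
        have "Poly_Mapping.lookup D \<alpha> - ?comb F c \<alpha> \<in> P" for \<alpha>
        proof (cases "index_deg \<alpha> < m")
          case True
          then show ?thesis by (intro F) simp
        next
          case False
          then show ?thesis
            using F(2) by (intro P_diff P_sum P_mult lookup_local_dual[OF I] D N_dual) auto
        qed
        then have "same_image P D (\<Sum>E\<in>F. wscale (c E) E)"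
          by (simp add: same_image_def lookup_sum lookup_wscale)
        then show False using nD F(1,2) unfolding kspan_def by blast
      qed
    qed
    then obtain v where v: "\<And>s. s \<in> S \<Longrightarrow> (\<Sum>\<alpha>\<in>?B. s \<alpha> * v \<alpha>) \<in> P"
      "(\<Sum>\<alpha>\<in>?B. Poly_Mapping.lookup D \<alpha> * v \<alpha>) \<notin> P" by blast
    obtain f where f: "\<And>\<beta>. index_deg \<beta> < m \<Longrightarrow> pdiff \<beta> f - v \<beta> \<in> P"
      using taylor_surjective[of m v] by blast
    have wf: "wact E f \<in> P \<longleftrightarrow> (\<Sum>\<alpha>\<in>?B. Poly_Mapping.lookup E \<alpha> * v \<alpha>) \<in> P"
      if "E \<in> local_dual P I" for E
    proof -
      have "(\<Sum>\<alpha>\<in>?B. Poly_Mapping.lookup E \<alpha> * (pdiff \<alpha> f - v \<alpha>)) \<in> P"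
        by (intro P_sum P_mult f) simp
      then have "(\<Sum>\<alpha>\<in>?B. Poly_Mapping.lookup E \<alpha> * pdiff \<alpha> f) - (\<Sum>\<alpha>\<in>?B. Poly_Mapping.lookup E \<alpha> * v \<alpha>) \<in> P"
        by (simp only: right_diff_distrib sum_subtractf)
      then show ?thesis using P_cong wact_local_dual[OF I that, of f] by blast
    qed
    have "wact E f \<in> P" if "E \<in> N" for E
    proof -
      have "Poly_Mapping.lookup E \<in> S"
        by (rule S_I[of "{E}" _ "\<lambda>_. 1"]) (simp_all add: that P_0)
      then show ?thesis using wf[OF N_dual[OF that]] v(1) by blast
    qed
    then have "f \<in> I" using N by blast
    then have "wact D f \<in> P" using D by (auto simp: local_dual_def)
    then show False using wf[OF D] v(2) by blast
  qed
qed

end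

theorem theorem3p10:
  fixes P I :: "('n::finite, 'k::field_char_0) mpoly set"
  assumes "maximal_ideal P" and "P_primary P I"
  shows "(\<forall>(D :: 'i \<Rightarrow> ('n, 'k) weyl) (N :: 'i \<Rightarrow> ('n, 'k) weyl).
            spans_local_dual P I (range D) \<longrightarrow> (\<forall>i. same_image P (N i) (D i)) \<longrightarrow>
            noetherian_operators (range N) I)
       \<and> (\<forall>N :: 'i \<Rightarrow> ('n, 'k) weyl.
            noetherian_operators (range N) I \<longrightarrow> spans_local_dual P I (range N))"
proof -
  interpret mpoly_max_ideal P by unfold_locales (rule assms(1))
  obtain t where "local_parameters UNIV t" using ex_local_parameters by blast
  then interpret mpoly_local_parameters P t by unfold_locales
  have idl: "is_ideal I" and rad: "radical I = P"
    using assms(2) by (simp_all add: P_primary_def primary_ideal_def)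
  obtain m where m: "dpow m \<subseteq> I" using dpow_subset_primary[OF assms(2)] .
  show ?thesis
  proof (intro conjI allI impI)
    fix D N :: "'i \<Rightarrow> ('n, 'k) weyl"
    assume span: "spans_local_dual P I (range D)" and same: "\<forall>i. same_image P (N i) (D i)"
    have ND: "wact (N i) f \<in> P \<longleftrightarrow> wact (D i) f \<in> P" for i f
      using P_cong[OF wact_same_image] same by blast
    have "f \<in> I \<longleftrightarrow> (\<forall>i. wact (D i) f \<in> P)" for f
    proof
      assume "f \<in> I"
      then show "\<forall>i. wact (D i) f \<in> P"
        using span unfolding spans_local_dual_def local_dual_def by blast
    next
      assume f: "\<forall>i. wact (D i) f \<in> P"
      have "wact E f \<in> P" if "E \<in> local_dual P I" for E
      proof (rule wact_kspan)
        show "E \<in> kspan P (range D)" using that span unfolding spans_local_dual_def by blast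
      qed (use f in blast)
      then show "f \<in> I" using local_dual_separates[OF idl m] by blast
    qed
    then show "noetherian_operators (range N) I"
      by (simp add: noetherian_operators_def rad ND)
  next
    fix N :: "'i \<Rightarrow> ('n, 'k) weyl"
    assume "noetherian_operators (range N) I"
    then have N: "f \<in> I \<longleftrightarrow> (\<forall>E\<in>range N. wact E f \<in> P)" for f
      by (simp add: noetherian_operators_def rad)
    have "wact (N i) f \<in> P" if "f \<in> I" for i f
      using bspec[OF iffD1[OF N that] rangeI] .
    then have "range N \<subseteq> local_dual P I" by (auto simp: local_dual_def)
    then show "spans_local_dual P I (range N)"
      using local_dual_subset_kspan[OF m N] by (simp add: spans_local_dual_def)
  qed
qed

end
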